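(* Let $r\ge 2$, let $G$ be a group with center $Z(G)$, let $T$ be a full ordered $r$-ary tree with $N(T)\ge 2$ internal vertices and with leaves $1,\ldots,n$, and let $\omega\colon G^r\to G$ be an arbitrary function. There is a bijection $F_T\colon G\to G$ such that $$\omega_T(x_1,\ldots,x_n)=F_T(x_1\cdots x_n)\quad\text{for all }x_1,\ldots,x_n\in G$$ if and only if at least one of the following holds. (A) $\omega(x_1,\ldots,x_r)=a\,x_1\cdots x_r$ for some $a\in G$, and $(aZ(G))^{g_R(T)}=Z(G)$ in $G/Z(G)$. (B) $\omega(x_1,\ldots,x_r)=x_1\cdots x_r\,b$ for some $b\in G$, and $(bZ(G))^{g_L(T)}=Z(G)$ in $G/Z(G)$. (C) $\omega(x_1,\ldots,x_r)=d\,\psi(x_1\cdots x_r)$ for some $d\in Z(G)$ and $\psi\in\mathrm{Aut}(G)$, and $\psi^{g_D(T)}=\mathrm{id}_G$. The parameters ($a$; $b$; $(d,\psi)$, respectively) are unique within each family. Two different families can represent the same operation only when $\omega(x_1,\ldots,x_r)=c\,x_1\cdots x_r$ with $c\in Z(G)$; and for every such central translation $\omega$ and every full ordered $r$-ary tree $T$ with leaves $1,\dots,n$, there is a bijection $F_T\colon G\to G$ with $\omega_T(x_1,\ldots,x_n)=F_T(x_1\cdots x_n)$.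
   Context: A full ordered $r$-ary tree is either a single leaf or a root with an ordered $r$-tuple of full ordered $r$-ary subtrees (so every internal vertex has exactly $r$ ordered children). Leaves are numbered $1,\ldots,n$ from left to right. $N(T)$ is the number of internal vertices. For an operation $\omega\colon G^r\to G$, $\omega_T\colon G^n\to G$ is the operation obtained by placing $x_1,\ldots,x_n$ at the leaves in order and applying $\omega$ at each internal vertex to the values of its children in order (for the one-leaf tree $\omega_T(x)=x$). For a leaf $i$ of $T$, follow the path from the root to $i$. At each internal vertex on the path, the path enters one child; the subtrees rooted at the other children are left or right sibling subtrees. $\rho_T(i)$ is the total number of internal vertices in all right sibling subtrees encountered along the path, $\lambda_T(i)$ is the total number of internal vertices in all left sibling subtrees encountered, and $\delta_T(i)$ is the depth of the leaf $i$ (the root has depth $0$). Put $$g_R(T)=\gcd(\rho_T(1),\ldots,\rho_T(n)),\quad g_L(T)=\gcd(\lambda_T(1),\ldots,\lambda_T(n)),$$ $$g_D(T)=\gcd(\delta_T(2)-\delta_T(1),\ldots,\delta_T(n)-\delta_T(1)),$$ where the gcd of an all-zero list is $0$. *)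

theory Defs
  imports "HOL-Algebra.Algebra"
begin

section \<open>Groups\<close>

definition center :: "('a, 'b) monoid_scheme \<Rightarrow> 'a set" where
  "center G = {z \<in> carrier G. \<forall>x\<in>carrier G. z \<otimes>\<^bsub>G\<^esub> x = x \<otimes>\<^bsub>G\<^esub> z}"

text \<open>The Cartesian power \<open>G\<^sup>k\<close>; tuples are lists.\<close>

definition tuples :: "('a, 'b) monoid_scheme \<Rightarrow> nat \<Rightarrow> 'a list set" where
  "tuples G k = {xs. length xs = k \<and> set xs \<subseteq> carrier G}"

definition lprod :: "('a, 'b) monoid_scheme \<Rightarrow> 'a list \<Rightarrow> 'a" where
  "lprod G xs = foldr (\<otimes>\<^bsub>G\<^esub>) xs \<one>\<^bsub>G\<^esub>"

section \<open>Ordered trees\<close>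

datatype otree = Leaf | Node "otree list"

fun full_rary :: "nat \<Rightarrow> otree \<Rightarrow> bool" where
  "full_rary r Leaf \<longleftrightarrow> True"
| "full_rary r (Node ts) \<longleftrightarrow> length ts = r \<and> (\<forall>t\<in>set ts. full_rary r t)"

fun leaves :: "otree \<Rightarrow> nat" where
  "leaves Leaf = 1"
| "leaves (Node ts) = (\<Sum>t\<leftarrow>ts. leaves t)"

fun internal :: "otree \<Rightarrow> nat" where
  "internal Leaf = 0"
| "internal (Node ts) = Suc (\<Sum>t\<leftarrow>ts. internal t)"

text \<open>\<open>eval w T\<close> is the operation \<open>\<omega>\<^sub>T\<close>, meant for argument lists of length \<open>leaves T\<close>:
  the arguments are distributed over the children as consecutive blocks.\<close>

fun eval :: "('a list \<Rightarrow> 'a) \<Rightarrow> otree \<Rightarrow> 'a list \<Rightarrow> 'a"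
  and eval_children :: "('a list \<Rightarrow> 'a) \<Rightarrow> otree list \<Rightarrow> 'a list \<Rightarrow> 'a list" where
  "eval w Leaf xs = hd xs"
| "eval w (Node ts) xs = w (eval_children w ts xs)"
| "eval_children w [] xs = []"
| "eval_children w (t # ts) xs =
     eval w t (take (leaves t) xs) # eval_children w ts (drop (leaves t) xs)"

text \<open>The root-to-leaf paths, leaves taken from left to right.  A path is the list of the
  (0-based) indices of the children it enters.\<close>

function leaf_paths :: "otree \<Rightarrow> nat list list" where
  "leaf_paths Leaf = [[]]"
| "leaf_paths (Node ts) =
     concat (map (\<lambda>j. map ((#) j) (leaf_paths (ts ! j))) [0..<length ts])"
  by pat_completeness auto
termination
  by (relation "measure size") (auto simp: less_Suc_eq_le intro!: size_list_estimation')

lemma length_leaf_paths: "length (leaf_paths T) = leaves T"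
proof (induction T rule: leaf_paths.induct)
  case (2 ts)
  have "map (\<lambda>j. length (leaf_paths (ts ! j))) [0..<length ts] = map leaves ts"
    using 2 by (intro nth_equalityI) auto
  then show ?case
    by (simp add: length_concat comp_def)
qed simp

fun right_internal :: "otree \<Rightarrow> nat list \<Rightarrow> nat" where
  "right_internal (Node ts) (j # p) =
     (\<Sum>k\<in>{j<..<length ts}. internal (ts ! k)) + right_internal (ts ! j) p"
| "right_internal _ _ = 0"

fun left_internal :: "otree \<Rightarrow> nat list \<Rightarrow> nat" where
  "left_internal (Node ts) (j # p) =
     (\<Sum>k\<in>{..<j}. internal (ts ! k)) + left_internal (ts ! j) p"
| "left_internal _ _ = 0"

text \<open>Leaves are numbered from 1.\<close>

definition leaf_path :: "otree \<Rightarrow> nat \<Rightarrow> nat list" where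
  "leaf_path T i = leaf_paths T ! (i - 1)"

definition rho :: "otree \<Rightarrow> nat \<Rightarrow> nat" where
  "rho T i = right_internal T (leaf_path T i)"

definition lam :: "otree \<Rightarrow> nat \<Rightarrow> nat" where
  "lam T i = left_internal T (leaf_path T i)"

definition depth :: "otree \<Rightarrow> nat \<Rightarrow> nat" where
  "depth T i = length (leaf_path T i)"

definition g_R :: "otree \<Rightarrow> nat" where
  "g_R T = Gcd (rho T ` {1..leaves T})"

definition g_L :: "otree \<Rightarrow> nat" where
  "g_L T = Gcd (lam T ` {1..leaves T})"

definition g_D :: "otree \<Rightarrow> nat" where
  "g_D T = nat (Gcd ((\<lambda>i. int (depth T i) - int (depth T 1)) ` {2..leaves T}))"

section \<open>Operations depending only on the product\<close>

definition product_bijective ::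
    "('a, 'b) monoid_scheme \<Rightarrow> ('a list \<Rightarrow> 'a) \<Rightarrow> otree \<Rightarrow> bool" where
  "product_bijective G w T \<longleftrightarrow>
     (\<exists>F. bij_betw F (carrier G) (carrier G) \<and>
          (\<forall>xs\<in>tuples G (leaves T). eval w T xs = F (lprod G xs)))"

definition left_form ::
    "('a, 'b) monoid_scheme \<Rightarrow> nat \<Rightarrow> ('a list \<Rightarrow> 'a) \<Rightarrow> 'a \<Rightarrow> bool" where
  "left_form G r w a \<longleftrightarrow> a \<in> carrier G \<and> (\<forall>xs\<in>tuples G r. w xs = a \<otimes>\<^bsub>G\<^esub> lprod G xs)"

definition right_form ::
    "('a, 'b) monoid_scheme \<Rightarrow> nat \<Rightarrow> ('a list \<Rightarrow> 'a) \<Rightarrow> 'a \<Rightarrow> bool" where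
  "right_form G r w b \<longleftrightarrow> b \<in> carrier G \<and> (\<forall>xs\<in>tuples G r. w xs = lprod G xs \<otimes>\<^bsub>G\<^esub> b)"

text \<open>Elements of \<open>auto G\<close> are extensional, so equality in \<open>auto G\<close> is equality of
  maps on the carrier.\<close>

definition aut_form ::
    "('a, 'b) monoid_scheme \<Rightarrow> nat \<Rightarrow> ('a list \<Rightarrow> 'a) \<Rightarrow> 'a \<Rightarrow> ('a \<Rightarrow> 'a) \<Rightarrow> bool" where
  "aut_form G r w d \<psi> \<longleftrightarrow> d \<in> center G \<and> \<psi> \<in> auto G \<and>
     (\<forall>xs\<in>tuples G r. w xs = d \<otimes>\<^bsub>G\<^esub> \<psi> (lprod G xs))"

definition central_translation ::
    "('a, 'b) monoid_scheme \<Rightarrow> nat \<Rightarrow> ('a list \<Rightarrow> 'a) \<Rightarrow> bool" where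
  "central_translation G r w \<longleftrightarrow>
     (\<exists>c\<in>center G. \<forall>xs\<in>tuples G r. w xs = c \<otimes>\<^bsub>G\<^esub> lprod G xs)"

end

theory Submission
  imports Defs
begin

text \<open>
  Call the value at the root a function of the product when it factors as \<open>F (x\<^sub>1 \<cdots> x\<^sub>n)\<close>.

  Necessity rests on a descent through the tree.  Since \<open>F\<close> is injective, the value at the root
  determines the product of the leaves; padding with identities passes this on to every subtree, down
  to a vertex all of whose children are leaves, so that \<open>\<omega>\<close> itself determines the product of its
  arguments.  Conversely, let the leaves below one child of the root be filled in two ways with the
  same product, all other leaves being unchanged.  The value of \<open>\<omega>\<close> at the root is the same, hence so
  is the product of the children's values, and by cancellation the value at that child.
  Thus every subtree is a function of the product as well
  (\<open>product_determines_child\<close>), and \<open>\<omega> = f \<circ> prod\<close> for a bijection \<open>f\<close>.  A tree with at least two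
  internal vertices contains a vertex with two or more internal vertices in its subtree but none of
  whose children has that property.  Among its children there are two neighbours which are a leaf and a
  cherry (a vertex with only leaves below it), a cherry and a leaf, or two cherries.  Varying only the
  products \<open>x\<close>, \<open>y\<close> at these neighbours, the product of their values depends on \<open>x y\<close> alone.  Depending
  on the case, this says that \<open>x f(y)\<close>, \<open>f(x) y\<close> or \<open>f(x) f(y)\<close> is a function of \<open>x y\<close>, which are the
  right translations, the left translations, and the central multiples of automorphisms
  (\<open>operation_forms\<close>).

  For the exact conditions, the three families are treated at once as affine operations
  \<open>x \<mapsto> \<alpha>(prod x) c\<close>.  Moving all constants to the right end writes the value at the root as
  \<open>\<tau>\<^sub>1(x\<^sub>1) \<cdots> \<tau>\<^sub>n(x\<^sub>n) e\<close>, where each \<open>\<tau>\<^sub>i\<close> is an automorphism determined by the path to the leaf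
  \<open>i\<close> (\<open>eval_affine\<close>).  This is a function of the product iff all \<open>\<tau>\<^sub>i\<close> agree
  (\<open>product_bijective_iff_twists_agree\<close>).  In the three families \<open>\<tau>\<^sub>i\<close> is conjugation by
  \<open>a\<^bsup>N(T) - \<rho>(i)\<^esup>\<close>, conjugation by \<open>b\<^bsup>\<lambda>(i)\<^esup>\<close>, and \<open>\<psi>\<^bsup>\<delta>(i)\<^esup>\<close>.  As some leaf has \<open>\<rho> = 0\<close> and some
  leaf has \<open>\<lambda> = 0\<close>, agreement means that all \<open>a\<^bsup>\<rho>(i)\<^esup>\<close>, respectively all \<open>b\<^bsup>\<lambda>(i)\<^esup>\<close>, are central, and
  that all \<open>\<psi>\<^bsup>\<delta>(i)\<^esup>\<close> coincide.  The exponents annihilating an element of a group are the multiples of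
  its order, so finitely many such conditions amount to one condition at the gcd.
\<close>

section \<open>Products of lists\<close>

lemma lprod_Nil [simp]: "lprod G [] = \<one>\<^bsub>G\<^esub>"
  by (simp add: lprod_def)

lemma lprod_Cons [simp]: "lprod G (x # xs) = x \<otimes>\<^bsub>G\<^esub> lprod G xs"
  by (simp add: lprod_def)

context group
begin

lemma lprod_closed [simp, intro]: "set xs \<subseteq> carrier G \<Longrightarrow> lprod G xs \<in> carrier G"
  by (induction xs) auto

lemma lprod_append:
  "set xs \<subseteq> carrier G \<Longrightarrow> set ys \<subseteq> carrier G \<Longrightarrow> lprod G (xs @ ys) = lprod G xs \<otimes> lprod G ys"
  by (induction xs) (auto simp: m_assoc)

lemma lprod_ones [simp]: "lprod G (replicate n \<one>) = \<one>"
  by (induction n) auto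

lemma lprod_pad [simp]:
  "set xs \<subseteq> carrier G \<Longrightarrow> lprod G (replicate m \<one> @ xs @ replicate n \<one>) = lprod G xs"
proof -
  assume xs: "set xs \<subseteq> carrier G"
  have ones: "set (replicate k \<one>) \<subseteq> carrier G" for k
    by (simp add: set_replicate_conv_if)
  have "set (xs @ replicate n \<one>) \<subseteq> carrier G" using xs ones[of n] by simp
  then show ?thesis using xs ones by (simp only: lprod_append) simp
qed

lemma lprod_hom:
  assumes "h \<in> hom G G" "set xs \<subseteq> carrier G"
  shows "lprod G (map h xs) = h (lprod G xs)"
  using assms(2)
proof (induction xs)
  case Nil
  then show ?case using hom_one[OF assms(1)] is_group by simp
next
  case (Cons x xs)
  then show ?case using hom_mult[OF assms(1), of x "lprod G xs"] by auto
qed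

lemma lprod_single:
  "i < n \<Longrightarrow> x \<in> carrier G \<Longrightarrow> lprod G ((replicate n \<one>)[i := x]) = x"
proof (induction n arbitrary: i)
  case (Suc n)
  then show ?case by (cases i) auto
qed simp

lemma lprod_Cons_ones: "x \<in> carrier G \<Longrightarrow> lprod G (x # replicate n \<one>) = x"
  by simp

lemma Cons_ones_in_tuples:
  "x \<in> carrier G \<Longrightarrow> n \<ge> 1 \<Longrightarrow> x # replicate (n - 1) \<one> \<in> tuples G n"
  by (auto simp: tuples_def)

lemma lprod_powers:
  "a \<in> carrier G \<Longrightarrow> lprod G (map (\<lambda>t. a [^] (f t :: nat)) ts) = a [^] (\<Sum>t\<leftarrow>ts. f t)"
  by (induction ts) (auto simp: nat_pow_mult)

lemma lprod_central:
  assumes "set xs \<subseteq> center G"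
  shows "lprod G xs \<in> center G"
  using assms
proof (induction xs)
  case (Cons x xs)
  then have x: "x \<in> carrier G" "lprod G xs \<in> carrier G"
    and c: "\<And>y. y \<in> carrier G \<Longrightarrow> x \<otimes> y = y \<otimes> x"
           "\<And>y. y \<in> carrier G \<Longrightarrow> lprod G xs \<otimes> y = y \<otimes> lprod G xs"
    by (auto simp: center_def)
  have "x \<otimes> lprod G xs \<otimes> y = y \<otimes> (x \<otimes> lprod G xs)" if "y \<in> carrier G" for y
    using x c that by (metis m_assoc)
  then show ?case using x by (auto simp: center_def)
qed (simp add: center_def)

end

section \<open>Evaluation on trees\<close>

lemma length_eval_children [simp]: "length (eval_children w ts xs) = length ts"
  by (induction ts arbitrary: xs) auto

lemma leaves_pos:
  assumes "r \<ge> 1"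
  shows "full_rary r t \<Longrightarrow> leaves t \<ge> 1"
proof (induction t)
  case (Node ts)
  then obtain t ts' where "ts = t # ts'"
    using assms by (cases ts) auto
  with Node have "leaves t \<ge> 1" by simp
  with \<open>ts = t # ts'\<close> show ?case by simp
qed simp

lemma internal_eq_0_iff [simp]: "internal t = 0 \<longleftrightarrow> t = Leaf"
  by (cases t) auto

lemma eval_children_append:
  "length xs = (\<Sum>t\<leftarrow>us. leaves t) \<Longrightarrow>
   eval_children w (us @ vs) (xs @ ys) = eval_children w us xs @ eval_children w vs ys"
  by (induction us arbitrary: xs) auto


lemma eval_children_block:
  assumes "length as = (\<Sum>t\<leftarrow>us. leaves t)" "length xs = leaves t"
  shows "eval_children w (us @ t # vs) (as @ xs @ bs) =
           eval_children w us as @ eval w t xs # eval_children w vs bs"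
  using assms by (simp add: eval_children_append)

lemma eval_children_pair:
  "length xs = leaves s \<Longrightarrow> length ys = leaves t \<Longrightarrow>
   eval_children w [s, t] (xs @ ys) = [eval w s xs, eval w t ys]"
  by simp

lemma eval_children_Leaves:
  "\<forall>t\<in>set ts. t = Leaf \<Longrightarrow> length xs = length ts \<Longrightarrow> eval_children w ts xs = xs"
proof (induction ts arbitrary: xs)
  case (Cons t ts)
  then show ?case by (cases xs) auto
qed simp

lemma leaves_Leaves: "\<forall>t\<in>set ts. t = Leaf \<Longrightarrow> (\<Sum>t\<leftarrow>ts. leaves t) = length ts"
  by (induction ts) auto

lemma eval_children_closed:
  assumes "\<And>t xs. t \<in> set ts \<Longrightarrow> xs \<in> tuples G (leaves t) \<Longrightarrow> eval w t xs \<in> carrier G"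
    and "xs \<in> tuples G (\<Sum>t\<leftarrow>ts. leaves t)"
  shows "set (eval_children w ts xs) \<subseteq> carrier G"
  using assms
proof (induction ts arbitrary: xs)
  case (Cons t ts)
  have "take (leaves t) xs \<in> tuples G (leaves t)"
    "drop (leaves t) xs \<in> tuples G (\<Sum>t\<leftarrow>ts. leaves t)"
    using Cons.prems(2) by (auto simp: tuples_def dest: in_set_takeD in_set_dropD)
  with Cons show ?case by auto
qed simp

lemma eval_closed:
  assumes "w \<in> tuples G r \<rightarrow> carrier G"
  shows "full_rary r t \<Longrightarrow> xs \<in> tuples G (leaves t) \<Longrightarrow> eval w t xs \<in> carrier G"
proof (induction t arbitrary: xs)
  case Leaf
  then show ?case by (cases xs) (auto simp: tuples_def)
next
  case (Node ts)
  then have "set (eval_children w ts xs) \<subseteq> carrier G"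
    by (intro eval_children_closed) auto
  then have "eval_children w ts xs \<in> tuples G r"
    using Node.prems by (simp add: tuples_def)
  with assms show ?case by auto
qed

section \<open>Operations whose tree depends only on the product\<close>

locale rary_operation = group G for G (structure) +
  fixes r :: nat and w :: "'a list \<Rightarrow> 'a"
  assumes arity: "r \<ge> 2"
    and w_closed: "w \<in> tuples G r \<rightarrow> carrier G"
begin

definition determines_product :: "otree \<Rightarrow> bool" where
  "determines_product T \<longleftrightarrow> (\<forall>xs\<in>tuples G (leaves T). \<forall>ys\<in>tuples G (leaves T).
     eval w T xs = eval w T ys \<longrightarrow> lprod G xs = lprod G ys)"

definition product_determines :: "otree \<Rightarrow> bool" where
  "product_determines T \<longleftrightarrow> (\<forall>xs\<in>tuples G (leaves T). \<forall>ys\<in>tuples G (leaves T).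
     lprod G xs = lprod G ys \<longrightarrow> eval w T xs = eval w T ys)"

text \<open>This is \<open>determines_product\<close> for the tree with a single internal vertex, in terms of \<open>w\<close> itself.\<close>

definition product_recoverable :: bool where
  "product_recoverable \<longleftrightarrow> (\<forall>xs\<in>tuples G r. \<forall>ys\<in>tuples G r.
     w xs = w ys \<longrightarrow> lprod G xs = lprod G ys)"

lemma eval_children_in_carrier:
  "\<forall>t\<in>set ts. full_rary r t \<Longrightarrow> xs \<in> tuples G (\<Sum>t\<leftarrow>ts. leaves t) \<Longrightarrow>
   set (eval_children w ts xs) \<subseteq> carrier G"
  by (rule eval_children_closed) (auto intro: eval_closed[OF w_closed])

text \<open>Fill the leaves outside the child with identities: the value at the root then depends on the value
  at the child only, while the product of all leaves is the product at the child.\<close>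

lemma determines_product_child:
  assumes "determines_product (Node (us @ t # vs))"
  shows "determines_product t"
  unfolding determines_product_def
proof (intro ballI impI)
  fix xs ys
  assume xy: "xs \<in> tuples G (leaves t)" "ys \<in> tuples G (leaves t)" "eval w t xs = eval w t ys"
  define pad where "pad zs = replicate (\<Sum>t\<leftarrow>us. leaves t) \<one> @ zs @ replicate (\<Sum>t\<leftarrow>vs. leaves t) \<one>"
    for zs
  have "pad xs \<in> tuples G (leaves (Node (us @ t # vs)))"
    "pad ys \<in> tuples G (leaves (Node (us @ t # vs)))"
    using xy(1,2) by (auto simp: tuples_def pad_def)
  moreover have "eval w (Node (us @ t # vs)) (pad xs) = eval w (Node (us @ t # vs)) (pad ys)"
    using xy by (simp add: pad_def eval_children_block tuples_def)
  ultimately have "lprod G (pad xs) = lprod G (pad ys)"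
    using assms unfolding determines_product_def by blast
  then show "lprod G xs = lprod G ys"
    using xy(1,2) by (simp add: pad_def tuples_def)
qed

text \<open>Descending to children ends at a vertex whose children are all leaves, where the tree operation is
  the operation itself.\<close>

lemma product_recoverable_if_determines_product:
  "full_rary r T \<Longrightarrow> internal T \<ge> 1 \<Longrightarrow> determines_product T \<Longrightarrow> product_recoverable"
proof (induction T)
  case (Node ts)
  show ?case
  proof (cases "\<forall>t\<in>set ts. t = Leaf")
    case True
    then have "leaves (Node ts) = r" and "\<And>zs. zs \<in> tuples G r \<Longrightarrow> eval w (Node ts) zs = w zs"
      using Node.prems(1) by (auto simp: leaves_Leaves eval_children_Leaves tuples_def)
    then show ?thesis
      using Node.prems(3) unfolding determines_product_def product_recoverable_def by metis
  next
    case False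
    then obtain t where t: "t \<in> set ts" "t \<noteq> Leaf" by blast
    then obtain us vs where "ts = us @ t # vs" by (meson split_list)
    with Node.prems(3) have "determines_product t" using determines_product_child by blast
    moreover have "internal t \<ge> 1" using t(2) internal_eq_0_iff[of t] by linarith
    ultimately show ?thesis using Node t(1) by auto
  qed
qed simp

text \<open>Extend both tuples by identities to the whole vertex; the two values of \<open>w\<close>
  there agree because the total products do.  Since \<open>w\<close> does not forget the product of its arguments,
  the products of all children's values agree, and the values of the children outside the block \<open>ms\<close>
  cancel.  Single children give the descent to subtrees, pairs of neighbours give the functional
  equations for \<open>w\<close>.\<close>

lemma children_product_determined:
  assumes sep: "product_recoverable"
    and full: "full_rary r (Node (us @ ms @ vs))"
    and resp: "product_determines (Node (us @ ms @ vs))"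
    and xs: "xs \<in> tuples G (\<Sum>t\<leftarrow>ms. leaves t)" and ys: "ys \<in> tuples G (\<Sum>t\<leftarrow>ms. leaves t)"
    and eq: "lprod G xs = lprod G ys"
  shows "lprod G (eval_children w ms xs) = lprod G (eval_children w ms ys)"
proof -
  let ?T = "Node (us @ ms @ vs)"
  define as where "as = replicate (\<Sum>t\<leftarrow>us. leaves t) \<one>"
  define bs where "bs = replicate (\<Sum>t\<leftarrow>vs. leaves t) \<one>"
  define A where "A = eval_children w us as"
  define B where "B = eval_children w vs bs"
  have as: "as \<in> tuples G (\<Sum>t\<leftarrow>us. leaves t)" and bs: "bs \<in> tuples G (\<Sum>t\<leftarrow>vs. leaves t)"
    by (auto simp: as_def bs_def tuples_def)
  have AB: "set A \<subseteq> carrier G" "set B \<subseteq> carrier G"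
    using eval_children_in_carrier[of us as] eval_children_in_carrier[of vs bs] full as bs
    by (simp_all add: A_def B_def)
  have key: "as @ zs @ bs \<in> tuples G (leaves ?T)"
    "eval_children w (us @ ms @ vs) (as @ zs @ bs) = A @ eval_children w ms zs @ B"
    "A @ eval_children w ms zs @ B \<in> tuples G r"
    "set (eval_children w ms zs) \<subseteq> carrier G"
    "lprod G (as @ zs @ bs) = lprod G zs"
    if zs: "zs \<in> tuples G (\<Sum>t\<leftarrow>ms. leaves t)" for zs
  proof -
    show "as @ zs @ bs \<in> tuples G (leaves ?T)"
      using zs as bs by (auto simp: tuples_def)
    show "eval_children w (us @ ms @ vs) (as @ zs @ bs) = A @ eval_children w ms zs @ B"
      using zs as by (simp add: eval_children_append tuples_def A_def B_def)
    show c: "set (eval_children w ms zs) \<subseteq> carrier G"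
      using full zs by (intro eval_children_in_carrier) auto
    show "A @ eval_children w ms zs @ B \<in> tuples G r"
      using c AB full by (simp add: tuples_def A_def B_def)
    show "lprod G (as @ zs @ bs) = lprod G zs"
      using zs by (simp add: as_def bs_def tuples_def)
  qed
  have "eval w ?T (as @ xs @ bs) = eval w ?T (as @ ys @ bs)"
    using resp key(1)[OF xs] key(1)[OF ys] key(5)[OF xs] key(5)[OF ys] eq
    unfolding product_determines_def by metis
  then have "w (A @ eval_children w ms xs @ B) = w (A @ eval_children w ms ys @ B)"
    using key(2)[OF xs] key(2)[OF ys] by simp
  then have "lprod G (A @ eval_children w ms xs @ B) = lprod G (A @ eval_children w ms ys @ B)"
    using sep key(3)[OF xs] key(3)[OF ys] unfolding product_recoverable_def by blast
  then have "lprod G A \<otimes> (lprod G (eval_children w ms xs) \<otimes> lprod G B) =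
             lprod G A \<otimes> (lprod G (eval_children w ms ys) \<otimes> lprod G B)"
    using AB key(4)[OF xs] key(4)[OF ys] by (simp add: lprod_append)
  then show ?thesis
    using lprod_closed[OF AB(1)] lprod_closed[OF AB(2)]
      lprod_closed[OF key(4)[OF xs]] lprod_closed[OF key(4)[OF ys]] by simp
qed

lemma product_determines_child:
  assumes sep: "product_recoverable"
    and full: "full_rary r (Node ts)" and resp: "product_determines (Node ts)" and t: "t \<in> set ts"
  shows "product_determines t"
proof -
  obtain us vs where ts: "ts = us @ t # vs" using t by (meson split_list)
  have ft: "full_rary r t" using full t by simp
  show ?thesis
    unfolding product_determines_def
  proof (intro ballI impI)
    fix xs ys
    assume xy: "xs \<in> tuples G (leaves t)" "ys \<in> tuples G (leaves t)" "lprod G xs = lprod G ys"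
    have "lprod G (eval_children w [t] xs) = lprod G (eval_children w [t] ys)"
      using full resp xy by (intro children_product_determined[OF sep, of us "[t]" vs]) (auto simp: ts)
    then show "eval w t xs = eval w t ys"
      using xy eval_closed[OF w_closed ft xy(1)] eval_closed[OF w_closed ft xy(2)]
      by (simp add: tuples_def)
  qed
qed

lemma product_determines_operation:
  assumes sep: "product_recoverable"
    and "full_rary r T" "internal T \<ge> 1" "product_determines T"
    and "xs \<in> tuples G r" "ys \<in> tuples G r" "lprod G xs = lprod G ys"
  shows "w xs = w ys"
  using assms(2-4)
proof (induction T)
  case (Node ts)
  show ?case
  proof (cases "\<forall>t\<in>set ts. t = Leaf")
    case True
    then have "leaves (Node ts) = r" and "\<And>zs. zs \<in> tuples G r \<Longrightarrow> eval w (Node ts) zs = w zs"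
      using Node.prems(1) by (auto simp: leaves_Leaves eval_children_Leaves tuples_def)
    then show ?thesis
      using Node.prems(3) assms(5-7) unfolding product_determines_def by metis
  next
    case False
    then obtain t where t: "t \<in> set ts" "t \<noteq> Leaf" by blast
    then have "product_determines t" using product_determines_child[OF sep Node.prems(1,3)] by blast
    moreover have "internal t \<ge> 1" using t(2) internal_eq_0_iff[of t] by linarith
    moreover have "full_rary r t" using Node.prems(1) t(1) by simp
    ultimately show ?thesis using Node.IH t(1) by blast
  qed
qed simp

text \<open>Descend to children with at least two internal vertices as long as there is one.  At the end all
  children are leaves or have a single internal vertex, and at least one is not a leaf; it is one of
  two neighbours because the arity is at least two.\<close>

lemma ex_adjacent_small_children:
  assumes sep: "product_recoverable"
    and "full_rary r T" "internal T \<ge> 2" "product_determines T"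
  shows "\<exists>us s t vs. full_rary r (Node (us @ [s, t] @ vs)) \<and> product_determines (Node (us @ [s, t] @ vs)) \<and>
           internal s \<le> 1 \<and> internal t \<le> 1 \<and> (s \<noteq> Leaf \<or> t \<noteq> Leaf)"
  using assms(2-4)
proof (induction T)
  case (Node ts)
  show ?case
  proof (cases "\<exists>t\<in>set ts. internal t \<ge> 2")
    case True
    then obtain t where t: "t \<in> set ts" "internal t \<ge> 2" by blast
    then have "product_determines t" using product_determines_child[OF sep Node.prems(1,3)] by blast
    moreover have "full_rary r t" using Node.prems(1) t(1) by simp
    ultimately show ?thesis using Node.IH t by blast
  next
    case False
    have "internal (Node ts) = 1" if "\<forall>t\<in>set ts. t = Leaf"
      using that by (simp add: sum_list_eq_0_iff)
    then obtain t where "t \<in> set ts" "t \<noteq> Leaf"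
      using Node.prems(2) by (metis numeral_le_one_iff semiring_norm(69))
    then obtain i where i: "i < length ts" "ts ! i \<noteq> Leaf" by (metis in_set_conv_nth)
    \<comment> \<open>pair the child with its right neighbour, or with its left one if it is the last child\<close>
    define j where "j = (if Suc i < length ts then i else i - 1)"
    have j: "Suc j < length ts" "i = j \<or> i = Suc j"
      using i(1) arity Node.prems(1) by (auto simp: j_def)
    have ts: "ts = take j ts @ [ts ! j, ts ! Suc j] @ drop (Suc (Suc j)) ts"
      using j(1) by (simp add: Cons_nth_drop_Suc)
    have small: "internal (ts ! k) \<le> 1" if "k < length ts" for k
    proof -
      have "\<not> internal (ts ! k) \<ge> 2" using False nth_mem[OF that] by blast
      then show ?thesis by simp
    qed
    have "full_rary r (Node (take j ts @ [ts ! j, ts ! Suc j] @ drop (Suc (Suc j)) ts))"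
      "product_determines (Node (take j ts @ [ts ! j, ts ! Suc j] @ drop (Suc (Suc j)) ts))"
      using Node.prems(1,3) ts by (simp_all only: ts[symmetric])
    moreover have "internal (ts ! j) \<le> 1" "internal (ts ! Suc j) \<le> 1"
      using small j(1) by simp_all
    moreover have "ts ! j \<noteq> Leaf \<or> ts ! Suc j \<noteq> Leaf" using i(2) j(2) by auto
    ultimately show ?thesis by blast
  qed
qed simp

end

context group
begin

text \<open>The first identity at \<open>x = \<one>\<close> shows that \<open>f \<one>\<close> commutes with the image of \<open>f\<close>, which is all
  of \<open>G\<close>; after division by this central element \<open>f\<close> is multiplicative.\<close>

lemma scaled_automorphism:
  assumes "f \<in> carrier G \<rightarrow> carrier G"
    and "\<And>x y. x \<in> carrier G \<Longrightarrow> y \<in> carrier G \<Longrightarrow> f x \<otimes> f y = f (x \<otimes> y) \<otimes> f \<one>"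
    and "\<And>x y. x \<in> carrier G \<Longrightarrow> y \<in> carrier G \<Longrightarrow> f x \<otimes> f y = f \<one> \<otimes> f (x \<otimes> y)"
    and "bij_betw f (carrier G) (carrier G)"
  shows "f \<one> \<in> center G" "restrict (\<lambda>x. inv (f \<one>) \<otimes> f x) (carrier G) \<in> auto G"
proof -
  have f: "f x \<in> carrier G" if "x \<in> carrier G" for x by (rule funcset_mem[OF assms(1) that])
  have c: "f \<one> \<otimes> y = y \<otimes> f \<one>" if "y \<in> carrier G" for y
  proof -
    have "y \<in> f ` carrier G" using bij_betw_imp_surj_on[OF assms(4)] that by simp
    then obtain x where x: "x \<in> carrier G" and y: "y = f x" by blast
    have "f \<one> \<otimes> f x = f (\<one> \<otimes> x) \<otimes> f \<one>"
      by (rule assms(2)[OF one_closed x])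
    then show ?thesis unfolding y by (simp only: l_one[OF x])
  qed
  then show "f \<one> \<in> center G" using f[OF one_closed] unfolding center_def by blast
  let ?g = "\<lambda>x. inv (f \<one>) \<otimes> f x"
  have "?g (x \<otimes> y) = ?g x \<otimes> ?g y" if "x \<in> carrier G" "y \<in> carrier G" for x y
  proof -
    have "?g x \<otimes> ?g y = inv (f \<one>) \<otimes> (f x \<otimes> inv (f \<one>)) \<otimes> f y"
      using f that by (simp add: m_assoc)
    also have "f x \<otimes> inv (f \<one>) = inv (f \<one>) \<otimes> f x"
    proof -
      have "f \<one> \<otimes> (f x \<otimes> inv (f \<one>)) = f x"
        using f that c[of "f x \<otimes> inv (f \<one>)"] by (simp add: m_assoc)
      then show ?thesis using f that by (metis inv_closed inv_solve_left m_closed one_closed)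
    qed
    also have "inv (f \<one>) \<otimes> (inv (f \<one>) \<otimes> f x) \<otimes> f y = inv (f \<one>) \<otimes> (inv (f \<one>) \<otimes> (f x \<otimes> f y))"
      using f that by (simp add: m_assoc)
    also have "\<dots> = ?g (x \<otimes> y)"
      using f that assms(3)[OF that] by (simp add: m_assoc[symmetric])
    finally show ?thesis by simp
  qed
  moreover have "bij_betw ?g (carrier G) (carrier G)"
  proof -
    have "bij_betw (\<lambda>x. inv (f \<one>) \<otimes> x) (carrier G) (carrier G)"
      using f inj_on_cmult surj_const_mult by (simp add: bij_betw_def)
    from bij_betw_trans[OF assms(4) this] show ?thesis by (simp add: comp_def)
  qed
  ultimately show "restrict ?g (carrier G) \<in> auto G"
    using f by (auto simp: auto_def Bij_def hom_def)
qed

end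

context rary_operation
begin

text \<open>With \<open>w = f \<circ> prod\<close> and a neighbouring pair \<open>s\<close>, \<open>t\<close> of small children, the value at a child with
  leaf product \<open>x\<close> is \<open>h s x\<close>, which is \<open>x\<close> for a leaf and \<open>f x\<close> otherwise.  The product
  \<open>h s x \<otimes> h t y\<close> is a function of \<open>x \<otimes> y\<close>, so it may be computed with one of the two factors moved
  entirely to one side; the three shapes of the pair yield the three families.\<close>

lemma operation_forms:
  assumes full: "full_rary r T" and int: "internal T \<ge> 2" and pb: "product_bijective G w T"
  shows "(\<exists>a. left_form G r w a) \<or> (\<exists>b. right_form G r w b) \<or> (\<exists>d \<psi>. aut_form G r w d \<psi>)"
proof -
  obtain F where F: "bij_betw F (carrier G) (carrier G)"
    "\<And>xs. xs \<in> tuples G (leaves T) \<Longrightarrow> eval w T xs = F (lprod G xs)"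
    using pb unfolding product_bijective_def by blast
  have "determines_product T"
    unfolding determines_product_def
  proof (intro ballI impI)
    fix xs ys
    assume xy: "xs \<in> tuples G (leaves T)" "ys \<in> tuples G (leaves T)" "eval w T xs = eval w T ys"
    then have "lprod G xs \<in> carrier G" "lprod G ys \<in> carrier G"
      by (auto simp: tuples_def)
    moreover have "F (lprod G xs) = F (lprod G ys)" using F(2) xy by simp
    ultimately show "lprod G xs = lprod G ys"
      using F(1) unfolding bij_betw_def by (blast dest: inj_onD)
  qed
  then have sep: product_recoverable
    using product_recoverable_if_determines_product[OF full] int by simp
  have det: "product_determines T"
    unfolding product_determines_def using F(2) by auto
  define f where "f x = w (x # replicate (r - 1) \<one>)" for x
  have r1: "r \<ge> 1" using arity by simp
  have w_f: "w xs = f (lprod G xs)" if "xs \<in> tuples G r" for xs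
  proof -
    have c: "lprod G xs \<in> carrier G" using that by (auto simp: tuples_def)
    show ?thesis
      unfolding f_def
      by (rule product_determines_operation[OF sep full _ det that])
         (use int c Cons_ones_in_tuples[OF c r1] in simp_all)
  qed
  have f_closed: "f x \<in> carrier G" if "x \<in> carrier G" for x
    using w_closed Cons_ones_in_tuples[OF that r1] by (auto simp: f_def)
  have f_inj: "x = y" if "f x = f y" "x \<in> carrier G" "y \<in> carrier G" for x y
    
    using sep Cons_ones_in_tuples[OF that(2) r1] Cons_ones_in_tuples[OF that(3) r1] that
      lprod_Cons_ones[OF that(2)] lprod_Cons_ones[OF that(3)]
    unfolding product_recoverable_def f_def by metis
  have "\<exists>x\<in>carrier G. f x = y" if y: "y \<in> carrier G" for y
  proof -
    obtain z where z: "z \<in> carrier G" "F z = y"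
      using F(1) y by (metis bij_betw_imp_surj_on imageE)
    let ?xs = "z # replicate (leaves T - 1) \<one>"
    obtain ts where T: "T = Node ts" using int by (cases T) auto
    have xs: "?xs \<in> tuples G (leaves T)"
      by (rule Cons_ones_in_tuples[OF z(1) leaves_pos[OF r1 full]])
    have c: "eval_children w ts ?xs \<in> tuples G r"
      using eval_children_in_carrier[of ts ?xs] full xs by (simp add: T tuples_def)
    have "y = eval w T ?xs" using F(2)[OF xs] z by simp
    also have "\<dots> = f (lprod G (eval_children w ts ?xs))"
      using w_f[OF c] by (simp add: T)
    finally show ?thesis using c by (auto simp: tuples_def)
  qed
  then have f_bij: "bij_betw f (carrier G) (carrier G)"
    using f_closed f_inj by (intro bij_betwI') metis+
  obtain us s t vs where st: "full_rary r (Node (us @ [s, t] @ vs))"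
    "product_determines (Node (us @ [s, t] @ vs))" "internal s \<le> 1" "internal t \<le> 1"
    "s \<noteq> Leaf \<or> t \<noteq> Leaf"
    using ex_adjacent_small_children[OF sep full int det] by blast
  \<comment> \<open>the value at a small child as a function of the product of its leaves\<close>
  define h where "h u x = (if u = Leaf then x else f x)" for u x
  have h_eval: "eval w u xs = h u (lprod G xs)"
    if "full_rary r u" "internal u \<le> 1" "xs \<in> tuples G (leaves u)" for u xs
  proof (cases u)
    case Leaf
    then show ?thesis using that(3) by (cases xs) (auto simp: h_def tuples_def)
  next
    case (Node ts)
    then have "\<forall>t\<in>set ts. t = Leaf" using that(2) by (auto simp: sum_list_eq_0_iff)
    then show ?thesis
      using that Node w_f by (auto simp: leaves_Leaves eval_children_Leaves tuples_def h_def)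
  qed
  have fst: "full_rary r s" "full_rary r t" using st(1) by auto
  have pair: "h s x \<otimes> h t y = h s x' \<otimes> h t y'"
    if xy: "x \<in> carrier G" "y \<in> carrier G" "x' \<in> carrier G" "y' \<in> carrier G" "x \<otimes> y = x' \<otimes> y'"
    for x y x' y'
  proof -
    define block where
      "block x y = (x # replicate (leaves s - 1) \<one>) @ (y # replicate (leaves t - 1) \<one>)" for x y
    have ls: "leaves s \<ge> 1" "leaves t \<ge> 1" using leaves_pos[OF r1] fst by auto
    have block: "block x y \<in> tuples G (\<Sum>t\<leftarrow>[s, t]. leaves t)" "lprod G (block x y) = x \<otimes> y"
      "lprod G (eval_children w [s, t] (block x y)) = h s x \<otimes> h t y"
      if "x \<in> carrier G" "y \<in> carrier G" for x y
    proof -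
      note b = Cons_ones_in_tuples[OF that(1) ls(1)] Cons_ones_in_tuples[OF that(2) ls(2)]
      show "block x y \<in> tuples G (\<Sum>t\<leftarrow>[s, t]. leaves t)"
        using b by (simp add: block_def tuples_def)
      show "lprod G (block x y) = x \<otimes> y"
        using that b unfolding block_def by (subst lprod_append) (auto simp: tuples_def)
      have "h s x \<in> carrier G" "h t y \<in> carrier G"
        using that f_closed by (auto simp: h_def)
      then show "lprod G (eval_children w [s, t] (block x y)) = h s x \<otimes> h t y"
        using that b h_eval[OF fst(1) st(3) b(1)] h_eval[OF fst(2) st(4) b(2)]
        unfolding block_def by (subst eval_children_pair) (simp_all add: tuples_def)
    qed
    have "lprod G (block x y) = lprod G (block x' y')"
      using block(2) xy by simp
    then have "lprod G (eval_children w [s, t] (block x y)) =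
               lprod G (eval_children w [s, t] (block x' y'))"
      by (rule children_product_determined[OF sep st(1,2) block(1)[OF xy(1,2)] block(1)[OF xy(3,4)]])
    then show ?thesis using block(3) xy by simp
  qed
  have h1: "h s x \<otimes> h t y = h s (x \<otimes> y) \<otimes> h t \<one>"
    and h2: "h s x \<otimes> h t y = h s \<one> \<otimes> h t (x \<otimes> y)"
    if "x \<in> carrier G" "y \<in> carrier G" for x y
    using pair[of x y "x \<otimes> y" \<one>] pair[of x y \<one> "x \<otimes> y"] that by simp_all
  consider "s \<noteq> Leaf" "t = Leaf" | "s = Leaf" "t \<noteq> Leaf" | "s \<noteq> Leaf" "t \<noteq> Leaf"
    using st(5) by blast
  then show ?thesis
  proof cases
    case 1
    have "w xs = f \<one> \<otimes> lprod G xs" if "xs \<in> tuples G r" for xs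
    proof -
      have c: "lprod G xs \<in> carrier G" using that by (auto simp: tuples_def)
      have "f (lprod G xs) = f \<one> \<otimes> lprod G xs"
        using 1 h1[OF one_closed c] f_closed[OF c] c by (simp add: h_def)
      then show ?thesis using w_f[OF that] by simp
    qed
    then have "left_form G r w (f \<one>)"
      using f_closed[OF one_closed] by (simp add: left_form_def)
    then show ?thesis by blast
  next
    case 2
    have "w xs = lprod G xs \<otimes> f \<one>" if "xs \<in> tuples G r" for xs
    proof -
      have c: "lprod G xs \<in> carrier G" using that by (auto simp: tuples_def)
      have "f (lprod G xs) = lprod G xs \<otimes> f \<one>"
        using 2 h2[OF c one_closed] f_closed[OF c] c by (simp add: h_def)
      then show ?thesis using w_f[OF that] by simp
    qed
    then have "right_form G r w (f \<one>)"
      using f_closed[OF one_closed] by (simp add: right_form_def)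
    then show ?thesis by blast
  next
    case 3
    have eqs: "f x \<otimes> f y = f (x \<otimes> y) \<otimes> f \<one>" "f x \<otimes> f y = f \<one> \<otimes> f (x \<otimes> y)"
      if "x \<in> carrier G" "y \<in> carrier G" for x y
      using 3 h1[OF that] h2[OF that] by (simp_all add: h_def)
    have "f \<in> carrier G \<rightarrow> carrier G" using f_closed by blast
    note form = scaled_automorphism[OF this eqs f_bij]
    have "w xs = f \<one> \<otimes> restrict (\<lambda>x. inv (f \<one>) \<otimes> f x) (carrier G) (lprod G xs)"
      if "xs \<in> tuples G r" for xs
    proof -
      have c: "lprod G xs \<in> carrier G" using that by (auto simp: tuples_def)
      show ?thesis
        using c f_closed[OF c] f_closed[OF one_closed] w_f[OF that] by (simp add: m_assoc[symmetric])
    qed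
    then have "aut_form G r w (f \<one>) (restrict (\<lambda>x. inv (f \<one>) \<otimes> f x) (carrier G))"
      unfolding aut_form_def using form by blast
    then show ?thesis by blast
  qed
qed

end

section \<open>Affine operations\<close>

context group
begin

definition conjugate :: "'a \<Rightarrow> 'a \<Rightarrow> 'a" where
  "conjugate g x = g \<otimes> x \<otimes> inv g"

lemma conjugate_closed [simp]:
  "g \<in> carrier G \<Longrightarrow> x \<in> carrier G \<Longrightarrow> conjugate g x \<in> carrier G"
  by (simp add: conjugate_def)

lemma conjugate_one [simp]: "x \<in> carrier G \<Longrightarrow> conjugate \<one> x = x"
  by (simp add: conjugate_def)

lemma conjugate_mult:
  "g \<in> carrier G \<Longrightarrow> h \<in> carrier G \<Longrightarrow> x \<in> carrier G \<Longrightarrow>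
   conjugate (g \<otimes> h) x = conjugate g (conjugate h x)"
  by (simp add: conjugate_def m_assoc inv_mult_group)

lemma conjugate_commute:
  "g \<in> carrier G \<Longrightarrow> x \<in> carrier G \<Longrightarrow> g \<otimes> x = conjugate g x \<otimes> g"
  by (simp add: conjugate_def m_assoc)

lemma conjugate_hom: "g \<in> carrier G \<Longrightarrow> conjugate g \<in> hom G G"
  by (auto simp: hom_def conjugate_def m_assoc) (simp add: m_assoc[symmetric])

lemma conjugate_iso: "g \<in> carrier G \<Longrightarrow> conjugate g \<in> iso G G"
  unfolding iso_def
  by (auto simp: conjugate_hom conjugate_mult[symmetric]
        intro!: bij_betw_byWitness[where f' = "conjugate (inv g)"])

end

text \<open>Left translations are the case \<open>\<alpha> = \<close> conjugation by \<open>a\<close>, \<open>c = a\<close>; right translations the case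
  \<open>\<alpha> = id\<close>; and a central \<open>d\<close> may stand on either side of \<open>\<psi>\<close>.  Treating all three uniformly means
  that the tree has to be expanded only once.\<close>

locale affine_operation = group G for G (structure) +
  fixes r :: nat and w :: "'a list \<Rightarrow> 'a" and \<alpha> :: "'a \<Rightarrow> 'a" and c :: 'a
  assumes arity_pos: "r \<ge> 1"
    and \<alpha>_iso: "\<alpha> \<in> iso G G"
    and c_closed [simp]: "c \<in> carrier G"
    and w_affine: "xs \<in> tuples G r \<Longrightarrow> w xs = \<alpha> (lprod G xs) \<otimes> c"
begin

text \<open>Writing the value at a subtree as a product of twisted leaves times a constant on the right, the
  constant is the offset and the automorphism applied to a leaf is its twist.  To collect the constants
  of the children at the right end, the leaves below child \<open>j\<close> are conjugated by the product of the
  offsets of the children to the left of \<open>j\<close>.\<close>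

fun offset :: "otree \<Rightarrow> 'a" where
  "offset Leaf = \<one>"
| "offset (Node ts) = \<alpha> (lprod G (map offset ts)) \<otimes> c"

fun twist :: "otree \<Rightarrow> nat list \<Rightarrow> 'a \<Rightarrow> 'a" where
  "twist (Node ts) (j # p) x =
     \<alpha> (conjugate (lprod G (map offset (take j ts))) (twist (ts ! j) p x))"
| "twist (Node ts) [] x = x"
| "twist Leaf p x = x"

lemma \<alpha>_hom: "\<alpha> \<in> hom G G"
  using \<alpha>_iso by (simp add: iso_def)

lemma \<alpha>_closed [simp]: "x \<in> carrier G \<Longrightarrow> \<alpha> x \<in> carrier G"
  using \<alpha>_hom by (auto simp: hom_def)

lemma offset_closed [simp]: "offset t \<in> carrier G"
proof (induction t)
  case (Node ts)
  then have "set (map offset ts) \<subseteq> carrier G" by auto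
  then show ?case by (simp del: set_map)
qed simp

lemma offsets_closed [simp]: "lprod G (map offset ts) \<in> carrier G"
  by (rule lprod_closed) auto

lemma twist_iso: "twist t p \<in> iso G G"
proof (induction p arbitrary: t)
  case Nil
  have "twist t [] = (\<lambda>x. x)" by (cases t) auto
  then show ?case by (simp add: iso_set_refl)
next
  case (Cons j p)
  show ?case
  proof (cases t)
    case Leaf
    then have "twist t (j # p) = (\<lambda>x. x)" by auto
    then show ?thesis by (simp add: iso_set_refl)
  next
    case (Node ts)
    then have "twist t (j # p) =
        \<alpha> \<circ> (conjugate (lprod G (map offset (take j ts))) \<circ> twist (ts ! j) p)"
      by (auto simp: fun_eq_iff)
    also have "\<dots> \<in> iso G G"
      by (intro iso_set_trans[OF iso_set_trans[OF Cons.IH conjugate_iso] \<alpha>_iso]) simp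
    finally show ?thesis .
  qed
qed

lemma twist_closed [simp]: "x \<in> carrier G \<Longrightarrow> twist t p x \<in> carrier G"
  using twist_iso[of t p] by (auto simp: iso_def hom_def)

lemma twist_one [simp]: "twist t p \<one> = \<one>"
  using twist_iso[of t p] hom_one[of "twist t p" G G] is_group by (simp add: iso_def)

lemma set_map2_twist:
  "set xs \<subseteq> carrier G \<Longrightarrow> set (map2 (twist t) ps xs) \<subseteq> carrier G"
  by (auto dest: set_zip_rightD)

lemma w_closed: "w \<in> tuples G r \<rightarrow> carrier G"
  by (auto simp: w_affine tuples_def)

text \<open>Let \<open>P\<^sub>j\<close> be the twisted product of the leaves below child \<open>j\<close>, and \<open>e\<^sub>j\<close> its offset.  In
  \<open>P\<^sub>1 e\<^sub>1 P\<^sub>2 e\<^sub>2 \<cdots>\<close> the offsets move to the right end at the price of conjugating each \<open>P\<^sub>j\<close> by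
  \<open>e\<^sub>1 \<cdots> e\<^sub>j\<^sub>-\<^sub>1\<close>, and \<open>\<alpha>\<close> then acts on every factor of the result.\<close>

lemma eval_affine:
  "full_rary r t \<Longrightarrow> xs \<in> tuples G (leaves t) \<Longrightarrow>
   eval w t xs = lprod G (map2 (twist t) (leaf_paths t) xs) \<otimes> offset t"
proof (induction t arbitrary: xs)
  case Leaf
  then obtain x where "xs = [x]" "x \<in> carrier G"
    by (cases xs) (auto simp: tuples_def)
  then show ?case by simp
next
  case (Node ts)
  define below where
    "below p x = conjugate (lprod G (map offset (take (hd p) ts))) (twist (ts ! hd p) (tl p) x)"
    for p x
  define paths where "paths js = concat (map (\<lambda>j. map ((#) j) (leaf_paths (ts ! j))) js)" for js
  have twist_below: "twist (Node ts) p x = \<alpha> (below p x)" if "p \<in> set (paths js)" for p x js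
    using that by (auto simp: paths_def below_def)
  have below_closed: "set (map2 below ps zs) \<subseteq> carrier G" if "set zs \<subseteq> carrier G" for ps zs
    using that by (auto simp: below_def dest: set_zip_rightD)
  \<comment> \<open>\<open>us\<close> are the children already passed, whose offsets wait on the left of the remaining values\<close>
  have step: "lprod G (map offset us) \<otimes> lprod G (eval_children w vs zs) =
      lprod G (map2 below (paths [length us..<length ts]) zs) \<otimes> lprod G (map offset ts)"
    if "ts = us @ vs" "zs \<in> tuples G (\<Sum>t\<leftarrow>vs. leaves t)" for us vs zs
    using that
  proof (induction vs arbitrary: us zs)
    case Nil
    then show ?case by (simp add: paths_def tuples_def)
  next
    case (Cons t vs)
    define E where "E = lprod G (map offset us)"
    define xs1 where "xs1 = take (leaves t) zs"
    define xs2 where "xs2 = drop (leaves t) zs"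
    have zs: "zs = xs1 @ xs2" by (simp add: xs1_def xs2_def)
    have xs12: "xs1 \<in> tuples G (leaves t)" "xs2 \<in> tuples G (\<Sum>t\<leftarrow>vs. leaves t)"
      using Cons.prems(2)
      by (auto simp: xs1_def xs2_def tuples_def dest: in_set_takeD in_set_dropD)
    have t: "t \<in> set ts" "full_rary r t" using Cons.prems(1) Node.prems(1) by auto
    have E: "E \<in> carrier G" by (simp add: E_def)
    \<comment> \<open>the twisted leaves below the first remaining child, and the value of the further ones\<close>
    define P where "P = lprod G (map2 (twist t) (leaf_paths t) xs1)"
    define R where "R = lprod G (eval_children w vs xs2)"
    have set1: "set xs1 \<subseteq> carrier G" "set xs2 \<subseteq> carrier G" using xs12 by (auto simp: tuples_def)
    have P: "P \<in> carrier G" unfolding P_def by (intro lprod_closed set_map2_twist set1)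
    have R: "R \<in> carrier G"
      unfolding R_def using Cons.prems(1) Node.prems(1) xs12(2)
      by (intro lprod_closed eval_children_closed eval_closed[OF w_closed]) auto
    have "lprod G (eval_children w (t # vs) zs) = P \<otimes> offset t \<otimes> R"
      using Node.IH[OF t xs12(1)] by (simp add: xs1_def xs2_def P_def R_def)
    then have "E \<otimes> lprod G (eval_children w (t # vs) zs) = conjugate E P \<otimes> (E \<otimes> offset t \<otimes> R)"
      using conjugate_commute[OF E P] E P R by (simp add: m_assoc[symmetric])
    also have "E \<otimes> offset t = lprod G (map offset (us @ [t]))"
      unfolding E_def map_append by (subst lprod_append) auto
    also have "\<dots> \<otimes> R =
        lprod G (map2 below (paths [length (us @ [t])..<length ts]) xs2) \<otimes> lprod G (map offset ts)"
      unfolding R_def using Cons.prems(1) xs12(2) by (intro Cons.IH) simp_all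
    also have "conjugate E P = lprod G (map2 below (map ((#) (length us)) (leaf_paths t)) xs1)"
    proof -
      have "lprod G (map (conjugate E) (map2 (twist t) (leaf_paths t) xs1)) = conjugate E P"
        unfolding P_def by (intro lprod_hom conjugate_hom E set_map2_twist set1)
      moreover have "map (conjugate E) (map2 (twist t) (leaf_paths t) xs1) =
                     map2 below (map ((#) (length us)) (leaf_paths t)) xs1"
        using Cons.prems(1) by (simp add: zip_map1 below_def E_def split_def)
      ultimately show ?thesis by simp
    qed
    also have "\<dots> \<otimes> (lprod G (map2 below (paths [length (us @ [t])..<length ts]) xs2) \<otimes>
                 lprod G (map offset ts)) =
               lprod G (map2 below (paths [length us..<length ts]) zs) \<otimes> lprod G (map offset ts)"
    proof -
      have "[length us..<length ts] = length us # [length (us @ [t])..<length ts]"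
        using Cons.prems(1) by (subst upt_conv_Cons) simp_all
      then have "paths [length us..<length ts] =
          map ((#) (length us)) (leaf_paths t) @ paths [length (us @ [t])..<length ts]"
        using Cons.prems(1) by (simp add: paths_def)
      then have "map2 below (paths [length us..<length ts]) zs =
          map2 below (map ((#) (length us)) (leaf_paths t)) xs1 @
          map2 below (paths [length (us @ [t])..<length ts]) xs2"
        using xs12(1) by (simp add: zs tuples_def length_leaf_paths)
      then show ?thesis
        using below_closed[OF set1(1)] below_closed[OF set1(2)]
        by (simp add: lprod_append m_assoc lprod_closed del: set_map)
    qed
    finally show ?case by (simp add: E_def)
  qed
  have set_xs: "set xs \<subseteq> carrier G" using Node.prems(2) by (simp add: tuples_def)
  have ec: "set (eval_children w ts xs) \<subseteq> carrier G"
    using Node.prems by (intro eval_children_closed eval_closed[OF w_closed]) auto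
  let ?ps = "paths [0..<length ts]"
  have "eval w (Node ts) xs = \<alpha> (lprod G (eval_children w ts xs)) \<otimes> c"
    using ec Node.prems by (simp add: w_affine tuples_def)
  also have "lprod G (eval_children w ts xs) = lprod G (map2 below ?ps xs) \<otimes> lprod G (map offset ts)"
    using step[of "[]" ts xs] Node.prems(2) ec by simp
  also have "\<alpha> \<dots> = \<alpha> (lprod G (map2 below ?ps xs)) \<otimes> \<alpha> (lprod G (map offset ts))"
    using below_closed[OF set_xs] by (intro hom_mult[OF \<alpha>_hom] lprod_closed) auto
  also have "\<alpha> (lprod G (map2 below ?ps xs)) = lprod G (map \<alpha> (map2 below ?ps xs))"
    by (rule lprod_hom[OF \<alpha>_hom below_closed[OF set_xs], symmetric])
  also have "map \<alpha> (map2 below ?ps xs) = map2 (twist (Node ts)) ?ps xs"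
    using twist_below[of _ "[0..<length ts]"] by (auto dest: set_zip_leftD)
  also have "?ps = leaf_paths (Node ts)" by (simp add: paths_def)
  finally show ?case
    using set_map2_twist[OF set_xs, of "Node ts" "leaf_paths (Node ts)"]
    by (simp add: m_assoc lprod_closed del: leaf_paths.simps set_map)
qed

text \<open>Placing \<open>x\<close> at a single leaf and identities elsewhere isolates the twist of that leaf while the
  product stays \<open>x\<close>, so the twists agree.  Conversely, a common twist can be taken out of the product,
  and it is bijective.\<close>

lemma product_bijective_iff_twists_agree:
  assumes full: "full_rary r T"
  shows "product_bijective G w T \<longleftrightarrow>
    (\<forall>p\<in>set (leaf_paths T). \<forall>q\<in>set (leaf_paths T). \<forall>x\<in>carrier G. twist T p x = twist T q x)"
    (is "_ = ?agree")
proof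
  assume "product_bijective G w T"
  then obtain F where F: "\<And>xs. xs \<in> tuples G (leaves T) \<Longrightarrow> eval w T xs = F (lprod G xs)"
    unfolding product_bijective_def by blast
  have "twist T p x \<otimes> offset T = F x" if p: "p \<in> set (leaf_paths T)" and x: "x \<in> carrier G" for p x
  proof -
    obtain i where i: "i < leaves T" "leaf_paths T ! i = p"
      using p by (auto simp: in_set_conv_nth length_leaf_paths)
    let ?xs = "(replicate (leaves T) \<one>)[i := x]"
    have xs: "?xs \<in> tuples G (leaves T)"
      using set_update_subset_insert[of "replicate (leaves T) \<one>" i x] x
      by (auto simp: tuples_def set_replicate_conv_if split: if_splits)
    have "map2 (twist T) (leaf_paths T) ?xs = (replicate (leaves T) \<one>)[i := twist T p x]"
      using i by (intro nth_equalityI) (auto simp: length_leaf_paths nth_list_update)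
    then have "twist T p x \<otimes> offset T = eval w T ?xs"
      using eval_affine[OF full xs] i x by (simp add: lprod_single)
    also have "\<dots> = F x" using F[OF xs] i x by (simp add: lprod_single)
    finally show ?thesis .
  qed
  then show ?agree by (metis offset_closed right_cancel twist_closed)
next
  assume agree: ?agree
  have "leaf_paths T \<noteq> []"
    using leaves_pos[OF arity_pos full] length_leaf_paths[of T] by auto
  then have p: "hd (leaf_paths T) \<in> set (leaf_paths T)" by simp
  define \<tau> where "\<tau> = twist T (hd (leaf_paths T))"
  have \<tau>: "\<tau> \<in> iso G G" by (simp add: \<tau>_def twist_iso)
  let ?F = "\<lambda>x. \<tau> x \<otimes> offset T"
  have "bij_betw (\<lambda>x. x \<otimes> offset T) (carrier G) (carrier G)"
    by (intro bij_betw_byWitness[where f' = "\<lambda>x. x \<otimes> inv (offset T)"]) (auto simp: m_assoc)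
  then have "bij_betw ((\<lambda>x. x \<otimes> offset T) \<circ> \<tau>) (carrier G) (carrier G)"
    using \<tau> by (intro bij_betw_trans) (auto simp: iso_def)
  moreover have "eval w T xs = ?F (lprod G xs)" if xs: "xs \<in> tuples G (leaves T)" for xs
  proof -
    have "twist T q x = \<tau> x" if "q \<in> set (leaf_paths T)" "x \<in> carrier G" for q x
      using agree p that unfolding \<tau>_def by blast
    moreover have "leaf_paths T ! i \<in> set (leaf_paths T)" "xs ! i \<in> carrier G"
      if "i < leaves T" for i
      using that xs by (auto simp: tuples_def length_leaf_paths)
    ultimately have "map2 (twist T) (leaf_paths T) xs = map \<tau> xs"
      using xs by (intro nth_equalityI) (simp_all add: tuples_def length_leaf_paths)
    then show ?thesis
      using eval_affine[OF full xs] lprod_hom[of \<tau> xs] \<tau> xs by (simp add: iso_def tuples_def)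
  qed
  ultimately show "product_bijective G w T"
    unfolding product_bijective_def by (auto simp: comp_def)
qed

end

section \<open>Twists of the three families\<close>

lemma leaf_path_image: "leaf_path T ` {1..leaves T} = set (leaf_paths T)"
proof -
  have "leaf_path T ` {1..leaves T} = (!) (leaf_paths T) ` ((\<lambda>i. i - 1) ` {1..leaves T})"
    by (simp add: image_image leaf_path_def)
  also have "(\<lambda>i. i - 1) ` {1..leaves T} = {0..<leaves T}"
    by (force simp: image_iff intro: bexI[where x = "Suc _"])
  also have "(!) (leaf_paths T) ` {0..<leaves T} = set (leaf_paths T)"
    using nth_image[of "leaves T" "leaf_paths T"] by (simp add: length_leaf_paths)
  finally show ?thesis .
qed

lemma g_R_paths: "g_R T = Gcd (right_internal T ` set (leaf_paths T))"
  by (simp add: g_R_def rho_def image_image flip: leaf_path_image)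

lemma g_L_paths: "g_L T = Gcd (left_internal T ` set (leaf_paths T))"
  by (simp add: g_L_def lam_def image_image flip: leaf_path_image)

lemma leaf_paths_Node_iff:
  "p \<in> set (leaf_paths (Node ts)) \<longleftrightarrow>
   (\<exists>j q. p = j # q \<and> j < length ts \<and> q \<in> set (leaf_paths (ts ! j)))"
  by auto

text \<open>This is the rightmost leaf.\<close>

lemma ex_leaf_right_internal_0:
  assumes "r \<ge> 1"
  shows "full_rary r T \<Longrightarrow> \<exists>p\<in>set (leaf_paths T). right_internal T p = 0"
proof (induction T)
  case (Node ts)
  have ne: "length ts \<ge> 1" using assms Node.prems by simp
  define j where "j = length ts - 1"
  have j: "j < length ts" "{j<..<length ts} = {}" using ne by (auto simp: j_def)
  obtain p where "p \<in> set (leaf_paths (ts ! j))" "right_internal (ts ! j) p = 0"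
    using Node nth_mem[OF j(1)] by auto
  then have "j # p \<in> set (leaf_paths (Node ts))" "right_internal (Node ts) (j # p) = 0"
    using j by auto
  then show ?case by blast
qed simp

text \<open>This is the leftmost leaf.\<close>

lemma ex_leaf_left_internal_0:
  assumes "r \<ge> 1"
  shows "full_rary r T \<Longrightarrow> \<exists>p\<in>set (leaf_paths T). left_internal T p = 0"
proof (induction T)
  case (Node ts)
  have j: "0 < length ts" using assms Node.prems by simp
  obtain p where "p \<in> set (leaf_paths (ts ! 0))" "left_internal (ts ! 0) p = 0"
    using Node nth_mem[OF j] by auto
  then have "0 # p \<in> set (leaf_paths (Node ts))" "left_internal (Node ts) (0 # p) = 0"
    using j by auto
  then show ?case by blast
qed simp

lemma sum_list_take_nth: "j \<le> length ts \<Longrightarrow> (\<Sum>t\<leftarrow>take j ts. f t) = (\<Sum>k\<in>{..<j}. f (ts ! k))"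
  by (simp add: sum_list_sum_nth min_def atLeast0LessThan)

lemma sum_list_split_nth:
  fixes f :: "otree \<Rightarrow> nat"
  assumes "j < length ts"
  shows "(\<Sum>t\<leftarrow>ts. f t) = (\<Sum>t\<leftarrow>take j ts. f t) + f (ts ! j) + (\<Sum>k\<in>{j<..<length ts}. f (ts ! k))"
proof -
  have "(\<Sum>k\<in>{..<length ts}. f (ts ! k)) =
      (\<Sum>k\<in>{..<j} \<union> insert j {j<..<length ts}. f (ts ! k))"
    using assms by (intro sum.cong) auto
  also have "\<dots> = (\<Sum>k\<in>{..<j}. f (ts ! k)) + (\<Sum>k\<in>insert j {j<..<length ts}. f (ts ! k))"
    by (rule sum.union_disjoint) auto
  finally have "(\<Sum>k\<in>{..<length ts}. f (ts ! k)) =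
      (\<Sum>k\<in>{..<j}. f (ts ! k)) + (f (ts ! j) + (\<Sum>k\<in>{j<..<length ts}. f (ts ! k)))"
    by simp
  then show ?thesis
    using assms sum_list_take_nth[of "length ts" ts f] sum_list_take_nth[of j ts f] by simp
qed

context group
begin

lemma conjugate_eq_iff_central:
  assumes g: "g \<in> carrier G" and h: "h \<in> carrier G"
  shows "(\<forall>x\<in>carrier G. conjugate (g \<otimes> h) x = conjugate g x) \<longleftrightarrow> h \<in> center G"
proof -
  have "conjugate (g \<otimes> h) x = conjugate g x \<longleftrightarrow> h \<otimes> x = x \<otimes> h" if x: "x \<in> carrier G" for x
  proof -
    have "inj_on (conjugate g) (carrier G)"
      using conjugate_iso[OF g] by (simp add: iso_def bij_betw_def)
    then have "conjugate (g \<otimes> h) x = conjugate g x \<longleftrightarrow> conjugate h x = x"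
      using g h x by (simp add: conjugate_mult inj_on_eq_iff)
    also have "\<dots> \<longleftrightarrow> h \<otimes> x = x \<otimes> h"
      using h x by (metis conjugate_closed conjugate_commute right_cancel)
    finally show ?thesis .
  qed
  then show ?thesis using h by (simp add: center_def)
qed

text \<open>Every internal vertex contributes one factor \<open>a\<close>, placed in front of its leftmost leaf.  Exactly the
  vertices in right sibling subtrees of a leaf \<open>i\<close> contribute their factor after \<open>i\<close>, so \<open>x\<^sub>i\<close> is
  conjugated by the remaining power \<open>a\<^bsup>N(T) - \<rho>(i)\<^esup>\<close>; for the rightmost leaf this is \<open>a\<^bsup>N(T)\<^esup>\<close>, against
  which all others are compared.\<close>

lemma left_form_twists:
  assumes r: "r \<ge> 1" and full: "full_rary r T" and form: "left_form G r w a"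
  shows "product_bijective G w T \<longleftrightarrow>
    (\<forall>p\<in>set (leaf_paths T). a [^] right_internal T p \<in> center G)"
proof -
  have a: "a \<in> carrier G" using form by (simp add: left_form_def)
  interpret affine_operation G r w "conjugate a" a
  proof unfold_locales
    fix xs assume xs: "xs \<in> tuples G r"
    then have "lprod G xs \<in> carrier G" by (auto simp: tuples_def)
    then show "w xs = conjugate a (lprod G xs) \<otimes> a"
      using form xs conjugate_commute[OF a] by (simp add: left_form_def)
  qed (use a r conjugate_iso in auto)
  have offset: "offset t = a [^] internal t" for t
  proof (induction t)
    case (Node ts)
    then have "map offset ts = map (\<lambda>t. a [^] internal t) ts" by simp
    then have "lprod G (map offset ts) = a [^] (\<Sum>t\<leftarrow>ts. internal t)"
      by (simp only: lprod_powers[OF a])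
    then show ?case
      using a nat_pow_Suc2[OF a, of "\<Sum>t\<leftarrow>ts. internal t"]
      by (simp add: conjugate_commute[symmetric])
  qed simp
  have tw: "right_internal t p \<le> internal t \<and>
      twist t p x = conjugate (a [^] (internal t - right_internal t p)) x"
    if "p \<in> set (leaf_paths t)" "x \<in> carrier G" for t p x
    using that
  proof (induction t arbitrary: p)
    case (Node ts)
    then obtain j q where p: "p = j # q" "j < length ts" "q \<in> set (leaf_paths (ts ! j))"
      unfolding leaf_paths_Node_iff by blast
    define m where "m = (\<Sum>t\<leftarrow>take j ts. internal t)"
    define k where "k = internal (ts ! j) - right_internal (ts ! j) q"
    have IH: "right_internal (ts ! j) q \<le> internal (ts ! j)"
      "twist (ts ! j) q x = conjugate (a [^] k) x"
      using Node.IH[OF nth_mem[OF p(2)] p(3) Node.prems(2)] by (auto simp: k_def)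
    have le: "right_internal (Node ts) p \<le> internal (Node ts)"
      and diff: "internal (Node ts) - right_internal (Node ts) p = Suc (m + k)"
      using IH(1) sum_list_split_nth[OF p(2), of internal] by (simp_all add: p(1) m_def k_def)
    have "map offset (take j ts) = map (\<lambda>t. a [^] internal t) (take j ts)"
      by (simp add: offset)
    then have "lprod G (map offset (take j ts)) = a [^] m"
      by (simp only: lprod_powers[OF a] m_def)
    then have "twist (Node ts) p x = conjugate a (conjugate (a [^] m) (conjugate (a [^] k) x))"
      by (simp add: p(1) IH(2))
    also have "\<dots> = conjugate (a [^] Suc (m + k)) x"
      using a Node.prems(2) nat_pow_Suc2[OF a, of "m + k"]
      by (simp add: conjugate_mult[symmetric] nat_pow_mult)
    finally show ?case using le diff by simp
  qed simp
  obtain p0 where p0: "p0 \<in> set (leaf_paths T)" "right_internal T p0 = 0"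
    using ex_leaf_right_internal_0[OF r full] by blast
  have "(\<forall>x\<in>carrier G. twist T p x = twist T p0 x) \<longleftrightarrow> a [^] right_internal T p \<in> center G"
    if p: "p \<in> set (leaf_paths T)" for p
  proof -
    \<comment> \<open>compare with the rightmost leaf, whose twist is conjugation by the full power of \<open>a\<close>\<close>
    let ?g = "a [^] (internal T - right_internal T p)"
    have "a [^] internal T = ?g \<otimes> a [^] right_internal T p"
      using tw[OF p one_closed] a by (simp add: nat_pow_mult)
    then have "(\<forall>x\<in>carrier G. twist T p x = twist T p0 x) \<longleftrightarrow>
        (\<forall>x\<in>carrier G. conjugate (?g \<otimes> a [^] right_internal T p) x = conjugate ?g x)"
      using tw[OF p] tw[OF p0(1)] p0(2) by auto
    then show ?thesis using a conjugate_eq_iff_central by simp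
  qed
  then show ?thesis
    unfolding product_bijective_iff_twists_agree[OF full] using p0(1) by metis
qed

text \<open>Every internal vertex contributes one factor \<open>b\<close> behind its rightmost leaf, and the vertices whose
  factor precedes a leaf are those in its left sibling subtrees.  The leftmost leaf is not twisted at
  all.\<close>

lemma right_form_twists:
  assumes r: "r \<ge> 1" and full: "full_rary r T" and form: "right_form G r w b"
  shows "product_bijective G w T \<longleftrightarrow>
    (\<forall>p\<in>set (leaf_paths T). b [^] left_internal T p \<in> center G)"
proof -
  have b: "b \<in> carrier G" using form by (simp add: right_form_def)
  interpret affine_operation G r w "\<lambda>x. x" b
    using b r form
    by unfold_locales (auto simp: iso_set_refl right_form_def)
  have offset: "offset t = b [^] internal t" for t
  proof (induction t)
    case (Node ts)
    then have "map offset ts = map (\<lambda>t. b [^] internal t) ts" by simp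
    then have "lprod G (map offset ts) = b [^] (\<Sum>t\<leftarrow>ts. internal t)"
      by (simp only: lprod_powers[OF b])
    then show ?case by simp
  qed simp
  have tw: "twist t p x = conjugate (b [^] left_internal t p) x"
    if "p \<in> set (leaf_paths t)" "x \<in> carrier G" for t p x
    using that
  proof (induction t arbitrary: p)
    case (Node ts)
    then obtain j q where p: "p = j # q" "j < length ts" "q \<in> set (leaf_paths (ts ! j))"
      unfolding leaf_paths_Node_iff by blast
    have "map offset (take j ts) = map (\<lambda>t. b [^] internal t) (take j ts)"
      by (simp add: offset)
    then have "lprod G (map offset (take j ts)) = b [^] (\<Sum>k\<in>{..<j}. internal (ts ! k))"
      using p(2) by (simp only: lprod_powers[OF b]) (simp add: sum_list_take_nth)
    moreover have "twist (ts ! j) q x = conjugate (b [^] left_internal (ts ! j) q) x"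
      using Node.IH[OF nth_mem[OF p(2)] p(3) Node.prems(2)] .
    ultimately show ?case
      using b Node.prems(2) by (simp add: p(1) conjugate_mult[symmetric] nat_pow_mult)
  qed simp
  obtain p0 where p0: "p0 \<in> set (leaf_paths T)" "left_internal T p0 = 0"
    using ex_leaf_left_internal_0[OF r full] by blast
  have "(\<forall>x\<in>carrier G. twist T p x = twist T p0 x) \<longleftrightarrow> b [^] left_internal T p \<in> center G"
    if p: "p \<in> set (leaf_paths T)" for p
    using tw[OF p] tw[OF p0(1)] p0(2) b conjugate_eq_iff_central[OF one_closed, of "b [^] left_internal T p"]
    by simp
  then show ?thesis
    unfolding product_bijective_iff_twists_agree[OF full] using p0(1) by metis
qed

text \<open>All offsets are central, so no conjugation takes place and each vertex on the path contributes one
  application of \<open>\<psi>\<close>.\<close>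

lemma aut_form_twists:
  assumes r: "r \<ge> 1" and full: "full_rary r T" and form: "aut_form G r w d \<psi>"
  shows "product_bijective G w T \<longleftrightarrow>
    (\<forall>p\<in>set (leaf_paths T). \<forall>q\<in>set (leaf_paths T). \<forall>x\<in>carrier G.
       (\<psi> ^^ length p) x = (\<psi> ^^ length q) x)"
proof -
  have d: "d \<in> carrier G" "d \<in> center G" and \<psi>: "\<psi> \<in> iso G G"
    using form by (auto simp: aut_form_def center_def auto_def Bij_def iso_def)
  have \<psi>_closed: "\<psi> x \<in> carrier G" if "x \<in> carrier G" for x
    using \<psi> that by (auto simp: iso_def hom_def)
  interpret affine_operation G r w \<psi> d
  proof unfold_locales
    fix xs assume xs: "xs \<in> tuples G r"
    then have "\<psi> (lprod G xs) \<in> carrier G" by (auto simp: tuples_def intro: \<psi>_closed)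
    then show "w xs = \<psi> (lprod G xs) \<otimes> d"
      using form xs by (auto simp: aut_form_def center_def)
  qed (use r \<psi> d in auto)
  \<comment> \<open>surjectivity of \<open>\<psi>\<close> makes the image of a central element commute with everything\<close>
  have center_image: "\<psi> z \<in> center G" if z: "z \<in> center G" for z
  proof -
    have zc: "z \<in> carrier G" "\<And>y. y \<in> carrier G \<Longrightarrow> z \<otimes> y = y \<otimes> z"
      using z by (auto simp: center_def)
    have "\<psi> z \<otimes> x = x \<otimes> \<psi> z" if "x \<in> carrier G" for x
    proof -
      have "x \<in> \<psi> ` carrier G" using \<psi> that by (simp add: iso_def bij_betw_def)
      then obtain y where y: "y \<in> carrier G" "x = \<psi> y" by blast
      then show ?thesis using zc hom_mult[OF \<alpha>_hom] by metis
    qed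
    then show ?thesis using \<psi>_closed[OF zc(1)] by (simp add: center_def)
  qed
  have offset: "offset t \<in> center G" for t
  proof (induction t)
    case (Node ts)
    then have "lprod G (map offset ts) \<in> center G" by (intro lprod_central) auto
    then have "lprod G [\<psi> (lprod G (map offset ts)), d] \<in> center G"
      using center_image d(2) by (intro lprod_central) auto
    then show ?case using d(1) by simp
  qed (simp add: center_def)
  have tw: "twist t p x = (\<psi> ^^ length p) x"
    if "p \<in> set (leaf_paths t)" "x \<in> carrier G" for t p x
    using that
  proof (induction t arbitrary: p)
    case (Node ts)
    then obtain j q where p: "p = j # q" "j < length ts" "q \<in> set (leaf_paths (ts ! j))"
      unfolding leaf_paths_Node_iff by blast
    have "lprod G (map offset (take j ts)) \<in> center G"
      using offset by (intro lprod_central) auto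
    then have "conjugate (lprod G (map offset (take j ts))) y = y" if "y \<in> carrier G" for y
      using that by (auto simp: center_def conjugate_def m_assoc)
    moreover have "twist (ts ! j) q x = (\<psi> ^^ length q) x"
      using Node.IH[OF nth_mem[OF p(2)] p(3) Node.prems(2)] .
    ultimately show ?case
      using twist_closed[OF Node.prems(2), of "ts ! j" q] by (simp add: p(1))
  qed simp
  show ?thesis
    unfolding product_bijective_iff_twists_agree[OF full] using tw by simp
qed

section \<open>The gcd conditions\<close>

text \<open>Both sides say that the order of \<open>x\<close>, which is \<open>0\<close> when infinite, divides the elements of \<open>S\<close>.\<close>

lemma pow_Gcd_eq_one_iff:
  "x \<in> carrier G \<Longrightarrow> x [^] Gcd S = \<one> \<longleftrightarrow> (\<forall>n\<in>S. x [^] (n::nat) = \<one>)"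
  by (simp add: pow_eq_id dvd_Gcd_iff)

lemma center_normal: "center G \<lhd> G"
proof -
  have "subgroup (center G) G"
  proof
    fix x y assume x: "x \<in> center G" and y: "y \<in> center G"
    then have "lprod G [x, y] \<in> center G" by (intro lprod_central) auto
    then show "x \<otimes> y \<in> center G" using y by (simp add: center_def)
  next
    fix x assume x: "x \<in> center G"
    have "inv x \<otimes> y = y \<otimes> inv x" if y: "y \<in> carrier G" for y
    proof -
      have xc: "x \<in> carrier G" and "x \<otimes> y = y \<otimes> x" using x y by (auto simp: center_def)
      then have "y = inv x \<otimes> (y \<otimes> x)" using y by (metis inv_closed inv_solve_left m_closed)
      then have "y \<otimes> inv x = inv x \<otimes> (y \<otimes> x) \<otimes> inv x" by simp
      also have "\<dots> = inv x \<otimes> y" using xc y by (simp add: m_assoc)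
      finally show ?thesis by simp
    qed
    then show "inv x \<in> center G" using x by (simp add: center_def)
  qed (auto simp: center_def)
  moreover have "x \<otimes> h \<otimes> inv x \<in> center G" if "x \<in> carrier G" "h \<in> center G" for x h
  proof -
    have "x \<otimes> h \<otimes> inv x = h"
    proof -
      have h: "h \<in> carrier G" "x \<otimes> h = h \<otimes> x" using that by (auto simp: center_def)
      show ?thesis unfolding h(2) using h(1) that(1) by (simp add: m_assoc)
    qed
    then show ?thesis using that by simp
  qed
  ultimately show ?thesis by (simp add: normal_inv_iff)
qed

lemma center_coset_pow_Gcd:
  assumes a: "a \<in> carrier G"
  shows "(a <# center G) [^]\<^bsub>G Mod center G\<^esub> Gcd S = \<one>\<^bsub>G Mod center G\<^esub> \<longleftrightarrow>
    (\<forall>n\<in>S. a [^] (n::nat) \<in> center G)"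
proof -
  interpret Z: normal "center G" G by (rule center_normal)
  interpret Q: group "G Mod center G" by (rule Z.factorgroup_is_group)
  have coset: "a <# center G = center G #> a" using Z.coset_eq a by blast
  have "center G #> a \<in> carrier (G Mod center G)"
    using a by (auto simp: carrier_FactGroup)
  then have "(a <# center G) [^]\<^bsub>G Mod center G\<^esub> Gcd S = \<one>\<^bsub>G Mod center G\<^esub> \<longleftrightarrow>
      (\<forall>n\<in>S. center G #> a [^] n = center G)"
    using a by (simp add: coset Q.pow_Gcd_eq_one_iff del: one_FactGroup)
       (simp add: Z.FactGroup_pow)
  also have "\<dots> \<longleftrightarrow> (\<forall>n\<in>S. a [^] n \<in> center G)"
    using a coset_join1[OF _ _ Z.subgroup_axioms] coset_join2[OF _ Z.subgroup_axioms] by blast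
  finally show ?thesis .
qed

lemma AutoGroup_pow_apply:
  assumes "\<psi> \<in> auto G" "x \<in> carrier G"
  shows "(\<psi> [^]\<^bsub>AutoGroup G\<^esub> (n::nat)) x = (\<psi> ^^ n) x"
proof -
  interpret A: group "AutoGroup G" by (rule AutoGroup)
  have \<psi>: "\<psi> \<in> carrier (AutoGroup G)" using assms(1) by (simp add: AutoGroup_def)
  show ?thesis
    using assms(2)
  proof (induction n arbitrary: x)
    case 0
    then show ?case by (simp add: AutoGroup_def BijGroup_def)
  next
    case (Suc n)
    have "\<psi> [^]\<^bsub>AutoGroup G\<^esub> n \<in> auto G"
      using A.nat_pow_closed[OF \<psi>] by (simp add: AutoGroup_def)
    then have "(\<psi> [^]\<^bsub>AutoGroup G\<^esub> Suc n) x = (\<psi> [^]\<^bsub>AutoGroup G\<^esub> n) (\<psi> x)"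
      using assms(1) Suc.prems by (simp add: AutoGroup_def BijGroup_def auto_def compose_eq)
    moreover have "\<psi> x \<in> carrier G"
      using assms(1) Suc.prems by (auto simp: auto_def hom_def)
    ultimately show ?case using Suc.IH by (simp add: funpow_swap1)
  qed
qed

text \<open>Equality of two powers of \<open>\<psi>\<close> means that its order divides the difference of the exponents.  All
  differences of leaf depths are differences of those relative to the first leaf.\<close>

lemma aut_form_iff_g_D:
  assumes r: "r \<ge> 1" and full: "full_rary r T" and form: "aut_form G r w d \<psi>"
  shows "product_bijective G w T \<longleftrightarrow> \<psi> [^]\<^bsub>AutoGroup G\<^esub> g_D T = \<one>\<^bsub>AutoGroup G\<^esub>"
proof -
  interpret A: group "AutoGroup G" by (rule AutoGroup)
  have \<psi>: "\<psi> \<in> auto G" using form by (simp add: aut_form_def)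
  then have \<psi>': "\<psi> \<in> carrier (AutoGroup G)" by (simp add: AutoGroup_def)
  have pow_ext: "\<psi> [^]\<^bsub>AutoGroup G\<^esub> (n::nat) \<in> extensional (carrier G)" for n
    using A.nat_pow_closed[OF \<psi>', of n] by (simp add: AutoGroup_def auto_def Bij_def)
  have agree: "(\<forall>x\<in>carrier G. (\<psi> ^^ m) x = (\<psi> ^^ n) x) \<longleftrightarrow> int (A.ord \<psi>) dvd int n - int m" for m n
  proof -
    have "(\<forall>x\<in>carrier G. (\<psi> ^^ m) x = (\<psi> ^^ n) x) \<longleftrightarrow>
        \<psi> [^]\<^bsub>AutoGroup G\<^esub> m = \<psi> [^]\<^bsub>AutoGroup G\<^esub> n"
    proof
      assume *: "\<forall>x\<in>carrier G. (\<psi> ^^ m) x = (\<psi> ^^ n) x"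
      show "\<psi> [^]\<^bsub>AutoGroup G\<^esub> m = \<psi> [^]\<^bsub>AutoGroup G\<^esub> n"
      proof (rule extensionalityI[OF pow_ext pow_ext])
        fix x assume x: "x \<in> carrier G"
        then show "(\<psi> [^]\<^bsub>AutoGroup G\<^esub> m) x = (\<psi> [^]\<^bsub>AutoGroup G\<^esub> n) x"
          unfolding AutoGroup_pow_apply[OF \<psi> x] using * by blast
      qed
    next
      assume "\<psi> [^]\<^bsub>AutoGroup G\<^esub> m = \<psi> [^]\<^bsub>AutoGroup G\<^esub> n"
      then show "\<forall>x\<in>carrier G. (\<psi> ^^ m) x = (\<psi> ^^ n) x"
        by (metis AutoGroup_pow_apply[OF \<psi>])
    qed
    then show ?thesis using A.int_pow_eq[OF \<psi>', of "int m" "int n"] by (simp add: int_pow_int)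
  qed
  let ?D = "\<lambda>i. int (depth T i) - int (depth T 1)"
  let ?I = "{1..leaves T}"
  have pos: "1 \<in> ?I" using leaves_pos[OF r full] by simp
  have "product_bijective G w T \<longleftrightarrow>
      (\<forall>i\<in>?I. \<forall>j\<in>?I. int (A.ord \<psi>) dvd int (depth T j) - int (depth T i))"
    unfolding aut_form_twists[OF assms] agree leaf_path_image[symmetric] by (simp add: depth_def)
  also have "\<dots> \<longleftrightarrow> (\<forall>i\<in>?I. int (A.ord \<psi>) dvd ?D i)"
  proof
    assume *: "\<forall>i\<in>?I. int (A.ord \<psi>) dvd ?D i"
    show "\<forall>i\<in>?I. \<forall>j\<in>?I. int (A.ord \<psi>) dvd int (depth T j) - int (depth T i)"
    proof (intro ballI)
      fix i j assume "i \<in> ?I" "j \<in> ?I"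
      then have "int (A.ord \<psi>) dvd ?D j - ?D i" using * by (blast intro: dvd_diff)
      then show "int (A.ord \<psi>) dvd int (depth T j) - int (depth T i)" by simp
    qed
  qed (use pos in blast)
  also have "\<dots> \<longleftrightarrow> (\<forall>i\<in>{2..leaves T}. int (A.ord \<psi>) dvd ?D i)"
  proof -
    have "?I = insert 1 {2..leaves T}" using pos by auto
    then show ?thesis by simp
  qed
  also have "\<dots> \<longleftrightarrow> int (A.ord \<psi>) dvd Gcd (?D ` {2..leaves T})"
    by (simp add: dvd_Gcd_iff)
  also have "\<dots> \<longleftrightarrow> A.ord \<psi> dvd g_D T"
    unfolding g_D_def by (metis Gcd_int_greater_eq_0 int_dvd_int_iff int_nat_eq)
  also have "\<dots> \<longleftrightarrow> \<psi> [^]\<^bsub>AutoGroup G\<^esub> g_D T = \<one>\<^bsub>AutoGroup G\<^esub>"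
    using A.pow_eq_id[OF \<psi>'] by simp
  finally show ?thesis .
qed

lemma left_form_iff_g_R:
  assumes "r \<ge> 1" "full_rary r T" "left_form G r w a"
  shows "product_bijective G w T \<longleftrightarrow>
    (a <# center G) [^]\<^bsub>G Mod center G\<^esub> g_R T = \<one>\<^bsub>G Mod center G\<^esub>"
  using left_form_twists[OF assms] center_coset_pow_Gcd assms(3)
  by (simp add: g_R_paths left_form_def)

lemma right_form_iff_g_L:
  assumes "r \<ge> 1" "full_rary r T" "right_form G r w b"
  shows "product_bijective G w T \<longleftrightarrow>
    (b <# center G) [^]\<^bsub>G Mod center G\<^esub> g_L T = \<one>\<^bsub>G Mod center G\<^esub>"
  using right_form_twists[OF assms] center_coset_pow_Gcd assms(3)
  by (simp add: g_L_paths right_form_def)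

lemma central_translation_product_bijective:
  assumes "r \<ge> 1" "full_rary r T" "central_translation G r w"
  shows "product_bijective G w T"
proof -
  obtain c where c: "c \<in> center G" "left_form G r w c"
    using assms(3) by (auto simp: central_translation_def left_form_def center_def)
  have cc: "c \<in> carrier G" using c(1) by (simp add: center_def)
  have "c [^] n \<in> center G" for n :: nat
  proof (induction n)
    case 0
    then show ?case by (simp add: center_def)
  next
    case (Suc n)
    then have "lprod G [c [^] n, c] \<in> center G" using c(1) by (intro lprod_central) auto
    then show ?case using cc by simp
  qed
  then show ?thesis using left_form_twists[OF assms(1,2) c(2)] by blast
qed

end

section \<open>Uniqueness of parameters and overlap of the families\<close>

context group
begin

text \<open>Every group element is the product of some \<open>r\<close>-tuple, so \<open>w\<close> determines the function of the product.
  Comparing such functions at \<open>\<one>\<close> yields the parameters of the families.\<close>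

lemma functions_of_product_agree:
  assumes "r \<ge> 1" "x \<in> carrier G"
    and "\<forall>xs\<in>tuples G r. w xs = f (lprod G xs)" "\<forall>xs\<in>tuples G r. w xs = g (lprod G xs)"
  shows "f x = g x"
proof -
  have "x # replicate (r - 1) \<one> \<in> tuples G r" by (rule Cons_ones_in_tuples[OF assms(2,1)])
  then show ?thesis using assms(3,4) lprod_Cons_ones[OF assms(2)] by metis
qed

lemma auto_one: "\<psi> \<in> auto G \<Longrightarrow> \<psi> \<one> = \<one>"
  using hom_one[of \<psi> G G] is_group by (simp add: auto_def)

lemma left_form_unique:
  assumes "r \<ge> 1" "left_form G r w a" "left_form G r w a'"
  shows "a = a'"
  using functions_of_product_agree[of r \<one> w "\<lambda>x. a \<otimes> x" "\<lambda>x. a' \<otimes> x"] assms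
  by (simp add: left_form_def)

lemma right_form_unique:
  assumes "r \<ge> 1" "right_form G r w b" "right_form G r w b'"
  shows "b = b'"
  using functions_of_product_agree[of r \<one> w "\<lambda>x. x \<otimes> b" "\<lambda>x. x \<otimes> b'"] assms
  by (simp add: right_form_def)

lemma aut_form_unique:
  assumes r: "r \<ge> 1" and form: "aut_form G r w d \<psi>" and form': "aut_form G r w d' \<psi>'"
  shows "d = d' \<and> \<psi> = \<psi>'"
proof -
  have d: "d \<in> carrier G" "d' \<in> carrier G" and \<psi>: "\<psi> \<in> auto G" "\<psi>' \<in> auto G"
    using form form' by (auto simp: aut_form_def center_def)
  have eq: "d \<otimes> \<psi> x = d' \<otimes> \<psi>' x" if "x \<in> carrier G" for x
    by (rule functions_of_product_agree[OF r that, of w]) (use form form' in \<open>auto simp: aut_form_def\<close>)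
  have "d = d'" using eq[OF one_closed] d \<psi> by (simp add: auto_one)
  moreover have "\<psi> = \<psi>'"
  proof (rule extensionalityI)
    show "\<psi> \<in> extensional (carrier G)" "\<psi>' \<in> extensional (carrier G)"
      using \<psi> by (simp_all add: auto_def Bij_def)
    fix x assume x: "x \<in> carrier G"
    then have "\<psi> x \<in> carrier G" "\<psi>' x \<in> carrier G" using \<psi> by (auto simp: auto_def hom_def)
    then show "\<psi> x = \<psi>' x" using eq[OF x] d \<open>d = d'\<close> by simp
  qed
  ultimately show ?thesis by simp
qed

lemma left_right_form_central:
  assumes r: "r \<ge> 1" and l: "left_form G r w a" and rt: "right_form G r w b"
  shows "central_translation G r w"
proof -
  have ab: "a \<in> carrier G" "b \<in> carrier G" using l rt by (auto simp: left_form_def right_form_def)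
  have eq: "a \<otimes> x = x \<otimes> b" if "x \<in> carrier G" for x
    by (rule functions_of_product_agree[OF r that, of w])
       (use l rt in \<open>auto simp: left_form_def right_form_def\<close>)
  have "a = b" using eq[OF one_closed] ab by simp
  then have "a \<in> center G" using eq ab unfolding center_def by blast
  then show ?thesis using l unfolding central_translation_def left_form_def by blast
qed

lemma left_aut_form_central:
  assumes r: "r \<ge> 1" and l: "left_form G r w a" and form: "aut_form G r w d \<psi>"
  shows "central_translation G r w"
proof -
  have "a \<otimes> \<one> = d \<otimes> \<psi> \<one>"
    by (rule functions_of_product_agree[OF r one_closed, of w])
       (use l form in \<open>auto simp: left_form_def aut_form_def\<close>)
  then have "a = d" using l form by (simp add: left_form_def aut_form_def auto_one center_def)
  then show ?thesis
    using l form unfolding central_translation_def left_form_def aut_form_def by blast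
qed

lemma right_aut_form_central:
  assumes r: "r \<ge> 1" and rt: "right_form G r w b" and form: "aut_form G r w d \<psi>"
  shows "central_translation G r w"
proof -
  have "\<one> \<otimes> b = d \<otimes> \<psi> \<one>"
    by (rule functions_of_product_agree[OF r one_closed, of w])
       (use rt form in \<open>auto simp: right_form_def aut_form_def\<close>)
  then have b: "b = d" using rt form by (simp add: right_form_def aut_form_def auto_one center_def)
  have d: "d \<in> center G" using form by (simp add: aut_form_def)
  have "w xs = d \<otimes> lprod G xs" if "xs \<in> tuples G r" for xs
  proof -
    have "lprod G xs \<in> carrier G" using that by (auto simp: tuples_def)
    then show ?thesis using rt d that b by (simp add: right_form_def center_def)
  qed
  then show ?thesis using d unfolding central_translation_def by blast
qed

end

theorem theorem3p4:
  fixes G :: "('a, 'b) monoid_scheme"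
    and r :: nat
    and T :: otree
    and \<omega> :: "'a list \<Rightarrow> 'a"
  assumes "group G"
    and "r \<ge> 2"
    and "full_rary r T"
    and "internal T \<ge> 2"
    and "\<omega> \<in> tuples G r \<rightarrow> carrier G"
  shows "(product_bijective G \<omega> T \<longleftrightarrow>
      (\<exists>a. left_form G r \<omega> a \<and>
           (a <#\<^bsub>G\<^esub> center G) [^]\<^bsub>G Mod center G\<^esub> g_R T = \<one>\<^bsub>G Mod center G\<^esub>) \<or>
      (\<exists>b. right_form G r \<omega> b \<and>
           (b <#\<^bsub>G\<^esub> center G) [^]\<^bsub>G Mod center G\<^esub> g_L T = \<one>\<^bsub>G Mod center G\<^esub>) \<or>
      (\<exists>d \<psi>. aut_form G r \<omega> d \<psi> \<and> \<psi> [^]\<^bsub>AutoGroup G\<^esub> g_D T = \<one>\<^bsub>AutoGroup G\<^esub>))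
    \<and> (\<forall>a a'. left_form G r \<omega> a \<and> left_form G r \<omega> a' \<longrightarrow> a = a')
    \<and> (\<forall>b b'. right_form G r \<omega> b \<and> right_form G r \<omega> b' \<longrightarrow> b = b')
    \<and> (\<forall>d \<psi> d' \<psi>'. aut_form G r \<omega> d \<psi> \<and> aut_form G r \<omega> d' \<psi>' \<longrightarrow> d = d' \<and> \<psi> = \<psi>')
    \<and> ((\<exists>a b. left_form G r \<omega> a \<and> right_form G r \<omega> b) \<or>
       (\<exists>a d \<psi>. left_form G r \<omega> a \<and> aut_form G r \<omega> d \<psi>) \<or>
       (\<exists>b d \<psi>. right_form G r \<omega> b \<and> aut_form G r \<omega> d \<psi>)
         \<longrightarrow> central_translation G r \<omega>)
    \<and> (\<forall>\<omega>' T'. central_translation G r \<omega>' \<and> full_rary r T' \<longrightarrow> product_bijective G \<omega>' T')"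
proof -
  interpret rary_operation G r \<omega>
    using assms by (simp add: rary_operation_def rary_operation_axioms_def)
  have r: "r \<ge> 1" using assms(2) by simp
  note criteria = left_form_iff_g_R[OF r assms(3), of \<omega>] right_form_iff_g_L[OF r assms(3), of \<omega>]
    aut_form_iff_g_D[OF r assms(3), of \<omega>]
  show ?thesis
  proof (intro conjI)
    show "product_bijective G \<omega> T \<longleftrightarrow>
      (\<exists>a. left_form G r \<omega> a \<and>
           (a <#\<^bsub>G\<^esub> center G) [^]\<^bsub>G Mod center G\<^esub> g_R T = \<one>\<^bsub>G Mod center G\<^esub>) \<or>
      (\<exists>b. right_form G r \<omega> b \<and>
           (b <#\<^bsub>G\<^esub> center G) [^]\<^bsub>G Mod center G\<^esub> g_L T = \<one>\<^bsub>G Mod center G\<^esub>) \<or>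
      (\<exists>d \<psi>. aut_form G r \<omega> d \<psi> \<and> \<psi> [^]\<^bsub>AutoGroup G\<^esub> g_D T = \<one>\<^bsub>AutoGroup G\<^esub>)"
      (is "_ \<longleftrightarrow> ?families")
    proof
      assume pb: "product_bijective G \<omega> T"
      from operation_forms[OF assms(3,4) pb] show ?families
        using criteria pb by blast
    next
      assume ?families
      then show "product_bijective G \<omega> T" using criteria by blast
    qed
    show "\<forall>a a'. left_form G r \<omega> a \<and> left_form G r \<omega> a' \<longrightarrow> a = a'"
      using left_form_unique[OF r] by blast
    show "\<forall>b b'. right_form G r \<omega> b \<and> right_form G r \<omega> b' \<longrightarrow> b = b'"
      using right_form_unique[OF r] by blast
    show "\<forall>d \<psi> d' \<psi>'. aut_form G r \<omega> d \<psi> \<and> aut_form G r \<omega> d' \<psi>' \<longrightarrow> d = d' \<and> \<psi> = \<psi>'"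
      using aut_form_unique[OF r] by blast
    show "(\<exists>a b. left_form G r \<omega> a \<and> right_form G r \<omega> b) \<or>
       (\<exists>a d \<psi>. left_form G r \<omega> a \<and> aut_form G r \<omega> d \<psi>) \<or>
       (\<exists>b d \<psi>. right_form G r \<omega> b \<and> aut_form G r \<omega> d \<psi>)
         \<longrightarrow> central_translation G r \<omega>"
      using left_right_form_central[OF r] left_aut_form_central[OF r] right_aut_form_central[OF r]
      by blast
    show "\<forall>\<omega>' T'. central_translation G r \<omega>' \<and> full_rary r T' \<longrightarrow> product_bijective G \<omega>' T'"
      using central_translation_product_bijective[OF r] by blast
  qed
qed

end
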